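(* Let $X$ be a finite-dimensional real normed space with $\dim X\geq 2$, let $\alpha,\beta>0$, and let $N\subseteq X$ be an $\alpha,\beta$-net in $X$, regarded as a pointed metric space with the metric induced by the norm and with a distinguished base point $0\in N$. Let $E=\{e_i\}_{i=1}^\infty$ be a retractional Schauder basis of the Lipschitz free space $\mathcal{F}(N)$. Then $E$ is conditional (i.e. not unconditional).
   Context: A subset $S$ of a metric space $M$ is an $\alpha,\beta$-net if $d(x,y)\geq\alpha$ for all distinct $x,y\in S$ and $\sup_{x\in M}d(x,S)\leq\beta$. For a metric space $(M,d)$ with distinguished point $0\in M$, $\operatorname{Lip}_0(M)$ is the Banach space of all Lipschitz functions $f:M\to\mathbb{R}$ with $f(0)=0$, with norm $\|f\|=\sup_{x\neq y}\frac{|f(x)-f(y)|}{d(x,y)}$. For $x\in M$, $\delta_x\in\operatorname{Lip}_0(M)^*$ is $\delta_x(f)=f(x)$. The Lipschitz free space is $\mathcal{F}(M)=\overline{\operatorname{span}}\{\delta_x: x\in M\}\subseteq \operatorname{Lip}_0(M)^*$ (norm closure); its dual is $\operatorname{Lip}_0(M)$. A retraction on $M$ is a map $\varphi:M\to M$ with $\varphi(x)=x$ for all $x\in\varphi(M)$. Retractional Schauder basis: let $M$ be an infinite pointed metric space. A Schauder basis of $\mathcal{F}(M)$ with canonical projections $P_n:\mathcal{F}(M)\to\mathcal{F}(M)$, $n\in\mathbb{N}$ (onto the span of the first $n$ basis vectors) is called retractional if there exist a sequence of distinct points $\{\mu_n\}_{n=0}^\infty\subseteq M$ with $\mu_0=0$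 and retractions $\varphi_n:M\to M$, $n\in\mathbb{N}_0$, such that (i) $\varphi_n(M)=\{\mu_j\}_{j=0}^n$ for every $n\in\mathbb{N}_0$; (ii) $\{\mu_j: j\in\mathbb{N}_0\}$ is dense in $M$; (iii) there exists $K>0$ such that $\varphi_n$ is $K$-Lipschitz for every $n\in\mathbb{N}_0$; (iv) $\varphi_m\varphi_n=\varphi_n\varphi_m=\varphi_n$ for all $m,n\in\mathbb{N}_0$ with $n\leq m$; and $P_n^*f=f\circ\varphi_n$ for every $f\in\operatorname{Lip}_0(M)$ and $n\in\mathbb{N}$. *)

theory Defs
  imports "HOL-Analysis.Analysis" "HOL-Library.Function_Algebras"
begin

instantiation "fun" :: (type, real_vector) real_vector
begin

definition scaleR_fun :: "real \<Rightarrow> ('a \<Rightarrow> 'b) \<Rightarrow> 'a \<Rightarrow> 'b"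
  where "scaleR_fun c f = (\<lambda>x. c *\<^sub>R f x)"

instance
  by standard (simp_all add: scaleR_fun_def fun_eq_iff algebra_simps)

end

section \<open>Nets\<close>

text \<open>
  The bound on \<^term>\<open>infdist\<close> is the condition that the supremum of the distances to \<open>S\<close> is at
  most \<open>\<beta>\<close>. Nonemptiness is required because \<^term>\<open>infdist x {}\<close> is 0 by convention, whereas the
  distance to the empty set is infinite.
\<close>

definition net_in :: "real \<Rightarrow> real \<Rightarrow> 'a::metric_space set \<Rightarrow> 'a set \<Rightarrow> bool"
  where "net_in \<alpha> \<beta> M S \<longleftrightarrow>
    S \<subseteq> M \<and> S \<noteq> {} \<and>
    (\<forall>x\<in>S. \<forall>y\<in>S. x \<noteq> y \<longrightarrow> dist x y \<ge> \<alpha>) \<and>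
    (\<forall>x\<in>M. infdist x S \<le> \<beta>)"

section \<open>Lipschitz free spaces\<close>

text \<open>
  Throughout, the pointed metric space is a subset \<open>M\<close> of a metric type with base point \<open>p\<close>.
  A real function on \<open>M\<close> is represented by its extension by 0 to the whole type, and a functional
  on the Lipschitz functions by its extension by 0; in this way equality, addition and scalar
  multiplication are those of the function type.
\<close>

definition Lip0 :: "'a::metric_space set \<Rightarrow> 'a \<Rightarrow> ('a \<Rightarrow> real) set"
  where "Lip0 M p = {f. (\<forall>x. x \<notin> M \<longrightarrow> f x = 0) \<and> f p = 0 \<and> (\<exists>C. C-lipschitz_on M f)}"

text \<open>Inserting 0 only matters for a one-point \<open>M\<close>, where the set of quotients is empty.\<close>

definition lip_norm :: "'a::metric_space set \<Rightarrow> ('a \<Rightarrow> real) \<Rightarrow> real"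
  where "lip_norm M f =
    Sup (insert 0 {\<bar>f x - f y\<bar> / dist x y | x y. x \<in> M \<and> y \<in> M \<and> x \<noteq> y})"

definition Lip0_dual :: "'a::metric_space set \<Rightarrow> 'a \<Rightarrow> (('a \<Rightarrow> real) \<Rightarrow> real) set"
  where "Lip0_dual M p = {\<phi>.
    (\<forall>f. f \<notin> Lip0 M p \<longrightarrow> \<phi> f = 0) \<and>
    (\<forall>f\<in>Lip0 M p. \<forall>g\<in>Lip0 M p. \<phi> (f + g) = \<phi> f + \<phi> g) \<and>
    (\<forall>c. \<forall>f\<in>Lip0 M p. \<phi> (c *\<^sub>R f) = c * \<phi> f) \<and>
    (\<exists>C. \<forall>f\<in>Lip0 M p. \<bar>\<phi> f\<bar> \<le> C * lip_norm M f)}"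

definition dual_norm :: "'a::metric_space set \<Rightarrow> 'a \<Rightarrow> (('a \<Rightarrow> real) \<Rightarrow> real) \<Rightarrow> real"
  where "dual_norm M p \<phi> = Sup {\<bar>\<phi> f\<bar> | f. f \<in> Lip0 M p \<and> lip_norm M f \<le> 1}"

definition point_eval :: "'a::metric_space set \<Rightarrow> 'a \<Rightarrow> 'a \<Rightarrow> ('a \<Rightarrow> real) \<Rightarrow> real"
  where "point_eval M p x = (\<lambda>f. if f \<in> Lip0 M p then f x else 0)"

definition lip_free :: "'a::metric_space set \<Rightarrow> 'a \<Rightarrow> (('a \<Rightarrow> real) \<Rightarrow> real) set"
  where "lip_free M p = {\<phi> \<in> Lip0_dual M p.
    \<forall>\<epsilon>>0. \<exists>\<psi>\<in>span (point_eval M p ` M). dual_norm M p (\<phi> - \<psi>) < \<epsilon>}"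

section \<open>Schauder bases\<close>

text \<open>
  Here the normed space is a linear subspace \<open>V\<close> of a real vector space, with norm \<open>nrm\<close> on \<open>V\<close>.
  Basis vectors are indexed from 0, so the first \<open>n\<close> of them are \<open>e 0, \<dots>, e (n - 1)\<close>.
\<close>

definition series_sums :: "('v::real_vector \<Rightarrow> real) \<Rightarrow> (nat \<Rightarrow> 'v) \<Rightarrow> 'v \<Rightarrow> bool"
  where "series_sums nrm s x \<longleftrightarrow> (\<lambda>n. nrm (x - (\<Sum>i<n. s i))) \<longlonglongrightarrow> 0"

definition schauder_basis :: "'v::real_vector set \<Rightarrow> ('v \<Rightarrow> real) \<Rightarrow> (nat \<Rightarrow> 'v) \<Rightarrow> bool"
  where "schauder_basis V nrm e \<longleftrightarrow>
    range e \<subseteq> V \<and> (\<forall>x\<in>V. \<exists>!a :: nat \<Rightarrow> real. series_sums nrm (\<lambda>i. a i *\<^sub>R e i) x)"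

definition basis_coeff :: "('v::real_vector \<Rightarrow> real) \<Rightarrow> (nat \<Rightarrow> 'v) \<Rightarrow> 'v \<Rightarrow> nat \<Rightarrow> real"
  where "basis_coeff nrm e x = (THE a. series_sums nrm (\<lambda>i. a i *\<^sub>R e i) x)"

definition basis_proj :: "('v::real_vector \<Rightarrow> real) \<Rightarrow> (nat \<Rightarrow> 'v) \<Rightarrow> nat \<Rightarrow> 'v \<Rightarrow> 'v"
  where "basis_proj nrm e n x = (\<Sum>i<n. basis_coeff nrm e x i *\<^sub>R e i)"

text \<open>A basis is unconditional if all rearrangements of all basis expansions converge.\<close>

definition unconditional_basis :: "'v::real_vector set \<Rightarrow> ('v \<Rightarrow> real) \<Rightarrow> (nat \<Rightarrow> 'v) \<Rightarrow> bool"
  where "unconditional_basis V nrm e \<longleftrightarrow>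
    schauder_basis V nrm e \<and>
    (\<forall>x\<in>V. \<forall>\<pi> :: nat \<Rightarrow> nat. bij \<pi> \<longrightarrow>
      (\<exists>y\<in>V. series_sums nrm (\<lambda>i. basis_coeff nrm e x (\<pi> i) *\<^sub>R e (\<pi> i)) y))"

definition conditional_basis :: "'v::real_vector set \<Rightarrow> ('v \<Rightarrow> real) \<Rightarrow> (nat \<Rightarrow> 'v) \<Rightarrow> bool"
  where "conditional_basis V nrm e \<longleftrightarrow>
    schauder_basis V nrm e \<and> \<not> unconditional_basis V nrm e"

section \<open>Retractional Schauder bases\<close>

text \<open>Unlike the library's \<^const>\<open>retraction\<close>, continuity is not required.\<close>

definition retraction_on :: "'a set \<Rightarrow> ('a \<Rightarrow> 'a) \<Rightarrow> bool"
  where "retraction_on M r \<longleftrightarrow> r \<in> M \<rightarrow> M \<and> (\<forall>x\<in>r ` M. r x = x)"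

text \<open>
  A function \<open>f\<close> in \<^term>\<open>Lip0 M p\<close> acts on the free space by evaluating functionals at \<open>f\<close>.
  Under this identification, the last condition states that the adjoint of the \<open>n\<close>-th canonical
  projection maps \<open>f\<close> to \<open>f \<circ> r n\<close> (extended by 0 outside \<open>M\<close>).
\<close>

definition retractional_basis ::
    "'a::metric_space set \<Rightarrow> 'a \<Rightarrow> (nat \<Rightarrow> ('a \<Rightarrow> real) \<Rightarrow> real) \<Rightarrow> bool"
  where "retractional_basis M p e \<longleftrightarrow>
    infinite M \<and> p \<in> M \<and>
    schauder_basis (lip_free M p) (dual_norm M p) e \<and>
    (\<exists>(\<mu> :: nat \<Rightarrow> 'a) (r :: nat \<Rightarrow> 'a \<Rightarrow> 'a).
      inj \<mu> \<and> range \<mu> \<subseteq> M \<and> \<mu> 0 = p \<and>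
      (\<forall>n. retraction_on M (r n)) \<and>
      (\<forall>n. r n ` M = \<mu> ` {..n}) \<and>
      M \<subseteq> closure (range \<mu>) \<and>
      (\<exists>K>0. \<forall>n. K-lipschitz_on M (r n)) \<and>
      (\<forall>m n. n \<le> m \<longrightarrow> (\<forall>x\<in>M. r m (r n x) = r n x \<and> r n (r m x) = r n x)) \<and>
      (\<forall>n\<ge>1. \<forall>f\<in>Lip0 M p. \<forall>\<phi>\<in>lip_free M p.
        basis_proj (dual_norm M p) e n \<phi> f = \<phi> (\<lambda>x. if x \<in> M then f (r n x) else 0)))"

end

theory Submission
  imports Defs
begin

text \<open>
  A retractional basis turns the net into a tree: the parent of \<open>\<mu> (Suc n)\<close> is \<open>r n (\<mu> (Suc n))\<close>, and
  up to scaling the basis vectors are the edges, that is, the differences between the evaluations at a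
  vertex and at its parent. The coefficients of \<open>\<delta>\<^sub>x - \<delta>\<^sub>y\<close> are those of the path from \<open>x\<close> to \<open>y\<close> in
  the tree. The proof shows that unconditionality would make the net look like this tree on a large
  scale, which is impossible in dimension at least 2.

  Every bounded function on a net is Lipschitz, in particular the parity of the depth in the tree, which
  takes a value of modulus 1 at all edges. Testing rearranged expansions against it, unconditional
  convergence implies that all coefficient sequences are absolutely summable
  (\<open>unconditional_imp_summable\<close>). A gliding hump argument makes this uniform: points of the net at
  distance at most \<open>R\<close> are joined by tree paths with a bounded number of edges
  (\<open>unconditional_imp_few_separating_descendants\<close>). As the retractions are uniformly Lipschitz and the
  net has no large gaps, edges have bounded length (\<open>parent_distance_bound\<close>). Consequently, the set of
  descendants of a vertex has its boundary within a bounded distance of that vertex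
  (\<open>unconditional_imp_boundary_near_ancestor\<close>).

  A bounded region does not separate a normed space of dimension at least 2 on a large scale. A branch
  from a remote point to the root has a vertex \<open>v\<close> far from both ends; its descendants contain the
  remote point but not the root, yet some path in the net joins these two while avoiding the
  neighbourhood of \<open>v\<close> that contains the boundary (\<open>boundaries_not_all_near_ancestors\<close>).
\<close>

section \<open>Rearrangements and a gliding hump\<close>

text \<open>
  The rearrangement is the limit of a growing chain of finite enumerations. The \<open>n\<close>-th extension
  first appends unused terms that lift the partial sum to at least \<open>n\<close>, then the index \<open>n\<close>
  itself unless it has already occurred; the second part makes the limit surjective.
\<close>

lemma divergent_rearrangement:
  fixes s :: "nat \<Rightarrow> real"
  assumes unbounded: "\<And>C. \<exists>F. finite F \<and> C \<le> (\<Sum>i\<in>F. max (s i) 0)"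
  shows "\<exists>\<pi>. bij \<pi> \<and> \<not> summable (\<lambda>i. s (\<pi> i))"
proof -
  have avoid: "\<exists>G. finite G \<and> G \<inter> F = {} \<and> C \<le> sum s G" if "finite F" for C F
  proof -
    obtain H where H: "finite H" "C + (\<Sum>i\<in>F. max (s i) 0) \<le> (\<Sum>i\<in>H. max (s i) 0)"
      using unbounded by blast
    define G where "G = {i \<in> H - F. s i > 0}"
    have "(\<Sum>i\<in>H. max (s i) 0) \<le> (\<Sum>i\<in>(H - F) \<union> F. max (s i) 0)"
      by (rule sum_mono2) (use H that in auto)
    also have "\<dots> = (\<Sum>i\<in>H - F. max (s i) 0) + (\<Sum>i\<in>F. max (s i) 0)"
      by (rule sum.union_disjoint) (use H that in auto)
    also have "(\<Sum>i\<in>H - F. max (s i) 0) = sum s G"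
      unfolding G_def using H by (intro sum.mono_neutral_cong_right) (auto simp: max_def)
    finally have "C \<le> sum s G" using H by linarith
    moreover have "finite G" "G \<inter> F = {}" using H by (auto simp: G_def)
    ultimately show ?thesis by blast
  qed
  define step where "step n l l' \<longleftrightarrow>
      (\<exists>g. l' = l @ g @ (if n \<in> set (l @ g) then [] else [n]) \<and> real n \<le> sum_list (map s (l @ g)))"
    for n :: nat and l l' :: "nat list"
  have "\<exists>L. \<forall>n. (distinct (L n) \<and> n \<le> length (L n)) \<and> step n (L n) (L (Suc n))"
  proof (rule dependent_nat_choice)
    show "\<exists>x. distinct x \<and> 0 \<le> length (x :: nat list)"
      by (rule exI[of _ "[]"]) simp
  next
    fix l n
    assume l: "distinct l \<and> n \<le> length (l :: nat list)"
    \<comment> \<open>The term \<open>\<bar>s 0\<bar> + 1\<close> only serves to make the new block nonempty, so that the enumerations grow.\<close>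
    obtain G where G: "finite G" "G \<inter> set l = {}"
        "max (real n - sum_list (map s l)) (\<bar>s 0\<bar> + 1) \<le> sum s G"
      using avoid[of "set l"] by blast
    have ne: "G \<noteq> {}" using G(3) by auto
    define g where "g = sorted_list_of_set G"
    define l' where "l' = l @ g @ (if n \<in> set (l @ g) then [] else [n])"
    have g: "set g = G" "distinct g" using G by (auto simp: g_def)
    have "g \<noteq> []" using ne g by auto
    then have len: "length g \<ge> 1" by (cases g) auto
    have "sum_list (map s g) = sum s G"
      using g by (metis sum_list_distinct_conv_sum_set)
    then have "real n \<le> sum_list (map s (l @ g))" using G(3) by simp
    then have "step n l l'" unfolding step_def l'_def by blast
    moreover have "distinct l'" using l g G by (auto simp: l'_def)
    moreover have "Suc n \<le> length l'" using l len by (auto simp: l'_def)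
    ultimately show "\<exists>y. (distinct y \<and> Suc n \<le> length y) \<and> step n l y" by blast
  qed
  then obtain L where dist: "\<And>n. distinct (L n)" and len: "\<And>n. n \<le> length (L n)"
    and step: "\<And>n. step n (L n) (L (Suc n))" by blast
  have ext: "\<exists>t. L m = L n @ t" if "n \<le> m" for n m
    using that
  proof (induction m rule: dec_induct)
    case (step m)
    then show ?case using \<open>\<And>n. step n (L n) (L (Suc n))\<close>[of m] unfolding step_def by auto
  qed auto
  define \<pi> where "\<pi> i = L (Suc i) ! i" for i
  have pi: "\<pi> i = L n ! i" if "i < length (L n)" for i n
  proof -
    have "i < length (L (Suc i))" using len[of "Suc i"] by simp
    then show ?thesis
      using that ext[of n "Suc i"] ext[of "Suc i" n] unfolding \<pi>_def
      by (metis nle_le nth_append)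
  qed
  have "inj \<pi>"
  proof (rule injI)
    fix i j assume eq: "\<pi> i = \<pi> j"
    define n where "n = Suc (max i j)"
    have "i < length (L n)" "j < length (L n)" using len[of n] by (auto simp: n_def)
    then show "i = j" using eq pi dist[of n] by (metis nth_eq_iff_index_eq)
  qed
  moreover have "surj \<pi>"
  proof -
    have "k \<in> range \<pi>" for k
    proof -
      have "k \<in> set (L (Suc k))" using step[of k] unfolding step_def by auto
      then show ?thesis using pi by (metis in_set_conv_nth rangeI)
    qed
    then show ?thesis by blast
  qed
  moreover have "\<not> summable (\<lambda>i. s (\<pi> i))"
  proof
    assume "summable (\<lambda>i. s (\<pi> i))"
    then have "Bseq (\<lambda>n. \<Sum>i<n. s (\<pi> i))"
      by (intro convergent_imp_Bseq) (simp add: summable_iff_convergent)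
    then obtain B where B: "\<And>n. \<bar>\<Sum>i<n. s (\<pi> i)\<bar> \<le> B" by (auto simp: Bseq_def)
    obtain n where n: "B < real n" using reals_Archimedean2 by blast
    obtain g t where g: "L (Suc n) = (L n @ g) @ t" "real n \<le> sum_list (map s (L n @ g))"
      using step[of n] unfolding step_def by auto
    let ?l = "L n @ g"
    have "sum_list (map s ?l) = (\<Sum>i<length ?l. s (?l ! i))"
      by (simp add: sum_list_sum_nth atLeast0LessThan del: map_append)
    also have "\<dots> = (\<Sum>i<length ?l. s (\<pi> i))"
    proof (rule sum.cong)
      fix i assume "i \<in> {..<length ?l}"
      then show "s (?l ! i) = s (\<pi> i)"
        using pi[of i "Suc n"] g(1) nth_append[of ?l t i] by simp
    qed simp
    finally have "real n \<le> (\<Sum>i<length ?l. s (\<pi> i))" using g by simp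
    then show False using B[of "length ?l"] n by linarith
  qed
  ultimately show ?thesis by (auto simp: bij_def)
qed

text \<open>
  Riemann's argument: if the absolute values diverge, then so do the positive or the negative parts.
\<close>

lemma summable_abs_if_rearrangements_summable:
  fixes s :: "nat \<Rightarrow> real"
  assumes "\<And>\<pi>. bij \<pi> \<Longrightarrow> summable (\<lambda>i. s (\<pi> i))"
  shows "summable (\<lambda>i. \<bar>s i\<bar>)"
proof -
  have bdd: "\<exists>C. \<forall>F. finite F \<longrightarrow> (\<Sum>i\<in>F. max (t i) 0) \<le> C"
    if "\<And>\<pi>. bij \<pi> \<Longrightarrow> summable (\<lambda>i. t (\<pi> i))" for t :: "nat \<Rightarrow> real"
    using divergent_rearrangement[of t] that by (meson linorder_le_cases)
  obtain C where C: "\<And>F. finite F \<Longrightarrow> (\<Sum>i\<in>F. max (s i) 0) \<le> C"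
    using bdd[of s] assms by blast
  obtain C' where C': "\<And>F. finite F \<Longrightarrow> (\<Sum>i\<in>F. max (- s i) 0) \<le> C'"
    using bdd[of "\<lambda>i. - s i"] assms by (auto simp: summable_minus_iff)
  show ?thesis
  proof (rule summableI_nonneg_bounded)
    fix n
    have "(\<Sum>i<n. \<bar>s i\<bar>) = (\<Sum>i<n. max (s i) 0) + (\<Sum>i<n. max (- s i) 0)"
      by (simp add: sum.distrib[symmetric] abs_if max_def) (intro sum.cong, auto)
    also have "\<dots> \<le> C + C'" by (intro add_mono C C') auto
    finally show "(\<Sum>i<n. \<bar>s i\<bar>) \<le> C + C'" .
  qed simp
qed

text \<open>
  This is the uniform boundedness principle for the coefficient map into \<open>\<ell>\<^sub>1\<close>, made explicit. The
  sequences \<open>t k\<close> and weights \<open>c k\<close> are chosen in turn: the weight so small that it disturbs the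
  finitely many coordinates used so far by at most \<open>2 ^ - k\<close> in total, then the sequence so large
  that its weighted \<open>\<ell>\<^sub>1\<close> norm exceeds all earlier contributions by \<open>k - 1\<close>. The hump of \<open>t k\<close> can
  then be cancelled neither by the earlier nor by the later terms.
\<close>

lemma gliding_hump:
  fixes T :: "(nat \<Rightarrow> real) set"
  assumes fin: "\<And>t. t \<in> T \<Longrightarrow> finite {i. t i \<noteq> 0}"
    and le1: "\<And>t i. t \<in> T \<Longrightarrow> \<bar>t i\<bar> \<le> 1"
    and unbounded: "\<And>C. \<exists>t\<in>T. \<exists>n. C < (\<Sum>i<n. \<bar>t i\<bar>)"
  shows "\<exists>c t. (\<forall>k. 0 \<le> c k) \<and> summable c \<and> range t \<subseteq> T \<and>
           \<not> summable (\<lambda>i. \<bar>\<Sum>k. c k * t k i\<bar>)"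
proof -
  define S where "S m t = (\<Sum>i<m. \<bar>t i\<bar>)" for m :: nat and t :: "nat \<Rightarrow> real"
  have big: "\<exists>t\<in>T. \<exists>m'\<ge>m. C < S m' t" for C m
  proof -
    obtain t n where t: "t \<in> T" "C < S n t" using unbounded unfolding S_def by blast
    have "S n t \<le> S (max n m) t" unfolding S_def by (rule sum_mono2) auto
    with t show ?thesis by (meson max.cobounded2 less_le_trans)
  qed
  \<comment> \<open>A state holds the current weight \<open>c\<close> and sequence \<open>t\<close>, a bound \<open>m\<close> for all supports so far, and the
        total weighted \<open>\<ell>\<^sub>1\<close> norm \<open>W\<close> of the sequences chosen so far.\<close>
  define P where "P n x \<longleftrightarrow> (case x of (c, t, m, W) \<Rightarrow>
      0 < c \<and> c \<le> (1/2)^n \<and> t \<in> T \<and> (\<forall>i\<ge>m. t i = 0) \<and> c * S m t \<le> W)" for n x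
  define Q where "Q n x y \<longleftrightarrow> (case (x, y) of ((c, t, m, W), (c', t', m', W')) \<Rightarrow>
        m \<le> m' \<and> c' * real m \<le> (1/2)^(Suc n) \<and> W' = W + c' * S m' t' \<and> real n + W \<le> c' * S m' t')"
    for n :: nat and x y :: "real \<times> (nat \<Rightarrow> real) \<times> nat \<times> real"
  have "\<exists>f. \<forall>n. P n (f n) \<and> Q n (f n) (f (Suc n))"
  proof (rule dependent_nat_choice)
    obtain t where "t \<in> T" using big by blast
    moreover from this obtain m where "\<forall>i\<ge>m. t i = 0"
      using fin[of t] by (metis (mono_tags) finite_nat_set_iff_bounded mem_Collect_eq not_le)
    ultimately have "P 0 (1, t, m, S m t)" by (simp add: P_def)
    then show "\<exists>x. P 0 x" by blast
  next
    fix x n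
    assume "P n x"
    obtain c t m W where xe: "x = (c, t, m, W)" by (cases x) auto
    have x: "0 < c" "c * S m t \<le> W" using \<open>P n x\<close> by (simp_all add: P_def xe)
    have "0 \<le> c * S m t" using x by (simp add: S_def sum_nonneg)
    then have W: "0 \<le> W" using x by linarith
    define c' where "c' = (1/2)^(Suc n) / (1 + real m)"
    have c': "0 < c'" by (simp add: c'_def)
    have c'm: "c' * (1 + real m) = (1/2)^(Suc n)" by (simp add: c'_def del: power_Suc)
    have "c' * 1 \<le> c' * (1 + real m)" "c' * real m \<le> c' * (1 + real m)"
      using c' by (intro mult_left_mono; simp)+
    then have c'': "c' \<le> (1/2)^(Suc n)" "c' * real m \<le> (1/2)^(Suc n)" using c'm by simp_all
    obtain t' k where t': "t' \<in> T" "k \<ge> m" "(real n + W) / c' < S k t'"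
      using big by blast
    obtain k' where k': "\<forall>i\<ge>k'. t' i = 0"
      using fin[OF t'(1)] by (metis (mono_tags) finite_nat_set_iff_bounded mem_Collect_eq not_le)
    define m' where "m' = max k k'"
    have "S k t' \<le> S m' t'" unfolding S_def m'_def by (rule sum_mono2) auto
    then have "(real n + W) / c' < S m' t'" using t' by linarith
    then have "real n + W \<le> c' * S m' t'" using c' by (simp add: field_simps)
    moreover have "\<forall>i\<ge>m'. t' i = 0" "m \<le> m'" using k' t' by (auto simp: m'_def)
    moreover have "P (Suc n) (c', t', m', W + c' * S m' t')"
      using c' c'' t'(1) W \<open>\<forall>i\<ge>m'. t' i = 0\<close> by (simp add: P_def del: power_Suc)
    ultimately have "P (Suc n) (c', t', m', W + c' * S m' t') \<and> Q n x (c', t', m', W + c' * S m' t')"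
      using c'' by (simp add: Q_def xe del: power_Suc)
    then show "\<exists>y. P (Suc n) y \<and> Q n x y" by blast
  qed
  then obtain f where f: "\<And>n. P n (f n)" "\<And>n. Q n (f n) (f (Suc n))" by blast
  define c t m W where "c n = fst (f n)" and "t n = fst (snd (f n))"
    and "m n = fst (snd (snd (f n)))" and "W n = snd (snd (snd (f n)))" for n
  have fe: "f n = (c n, t n, m n, W n)" for n
    by (simp add: c_def t_def m_def W_def)
  have c0: "0 < c n" and c2: "c n \<le> (1/2)^n" and tT: "t n \<in> T"
    and supp: "\<And>i. i \<ge> m n \<Longrightarrow> t n i = 0" and W0: "c n * S (m n) (t n) \<le> W n" for n
    using f(1)[of n] unfolding fe P_def by auto
  have mmono: "m n \<le> m (Suc n)" and cm: "c (Suc n) * real (m n) \<le> (1/2)^(Suc n)"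
    and Wsuc: "W (Suc n) = W n + c (Suc n) * S (m (Suc n)) (t (Suc n))"
    and hump: "real n + W n \<le> c (Suc n) * S (m (Suc n)) (t (Suc n))" for n
    using f(2)[of n] unfolding fe Q_def by (auto simp del: power_Suc)
  have mle: "m i \<le> m j" if "i \<le> j" for i j
    using that mmono by (rule lift_Suc_mono_le[rotated])
  have Sm: "S (m n) (t j) = S (m j) (t j)" if "j \<le> n" for j n
    unfolding S_def using mle[OF that] supp[of j]
    by (intro sum.mono_neutral_right) (auto simp: not_less)
  have Wsum: "(\<Sum>j\<le>n. c j * S (m j) (t j)) \<le> W n" for n
    by (induction n) (use W0 Wsuc in auto)
  have c_sum: "summable c"
    by (rule summable_comparison_test'[of "\<lambda>n. (1/2::real)^n" 0])
       (use c0 c2 in \<open>auto simp: less_imp_le\<close>)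
  have le: "\<bar>c k * t k i\<bar> \<le> c k" for k i
    using le1[OF tT, of k i] c0[of k] by (simp add: abs_mult mult_left_le)
  have abs_sum: "summable (\<lambda>k. \<bar>c k * t k i\<bar>)" for i
    by (rule summable_comparison_test'[OF c_sum, of 0]) (use le in auto)
  define u where "u i = (\<Sum>k. c k * t k i)" for i
  have large: "real n - 2 \<le> (\<Sum>i<m (Suc n). \<bar>u i\<bar>)" for n
  proof -
    let ?M = "m (Suc n)"
    define R where "R = (\<Sum>k. c (k + Suc (Suc n)))"
    have sR: "summable (\<lambda>k. c (k + Suc (Suc n)))" using c_sum by (rule summable_ignore_initial_segment)
    have tail: "real ?M * R \<le> 2"
    proof -
      have "real ?M * R = (\<Sum>k. real ?M * c (k + Suc (Suc n)))"
        unfolding R_def using sR by (simp add: suminf_mult)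
      also have "\<dots> \<le> (\<Sum>k. (1/2)^k)"
      proof (rule suminf_le)
        fix k
        have "real ?M * c (k + Suc (Suc n)) \<le> real (m (k + Suc n)) * c (k + Suc (Suc n))"
          using mle[of "Suc n" "k + Suc n"] c0[of "k + Suc (Suc n)"] by (intro mult_right_mono) auto
        also have "\<dots> \<le> (1/2)^(Suc (k + Suc n))" using cm[of "k + Suc n"] by (simp add: mult.commute)
        also have "\<dots> \<le> (1/2)^k" by (rule power_decreasing) auto
        finally show "real ?M * c (k + Suc (Suc n)) \<le> (1/2)^k" .
      qed (use sR in \<open>auto intro: summable_mult\<close>)
      also have "\<dots> = 2" by (subst suminf_geometric) auto
      finally show ?thesis .
    qed
    \<comment> \<open>In each coordinate, the hump is at most the limit plus the earlier and the later terms.\<close>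
    have pt: "c (Suc n) * \<bar>t (Suc n) i\<bar> \<le> \<bar>u i\<bar> + (\<Sum>j\<le>n. c j * \<bar>t j i\<bar>) + R" for i
    proof -
      have "u i = (\<Sum>k. c (k + Suc (Suc n)) * t (k + Suc (Suc n)) i) + (\<Sum>k<Suc (Suc n). c k * t k i)"
        unfolding u_def by (rule suminf_split_initial_segment[OF summable_rabs_cancel[OF abs_sum]])
      moreover have "\<bar>\<Sum>k. c (k + Suc (Suc n)) * t (k + Suc (Suc n)) i\<bar> \<le> R"
      proof -
        have s: "summable (\<lambda>k. \<bar>c (k + Suc (Suc n)) * t (k + Suc (Suc n)) i\<bar>)"
          using abs_sum by (rule summable_ignore_initial_segment)
        show ?thesis unfolding R_def
          by (rule order_trans[OF summable_rabs[OF s] suminf_le[OF le s sR]])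
      qed
      moreover have "\<bar>\<Sum>k\<le>n. c k * t k i\<bar> \<le> (\<Sum>j\<le>n. c j * \<bar>t j i\<bar>)"
        by (rule order_trans[OF sum_abs]) (simp add: abs_mult less_imp_le[OF c0])
      moreover have "(\<Sum>k<Suc (Suc n). c k * t k i) = (\<Sum>k\<le>n. c k * t k i) + c (Suc n) * t (Suc n) i"
        by (simp add: lessThan_Suc_atMost)
      moreover have "c (Suc n) * \<bar>t (Suc n) i\<bar> = \<bar>c (Suc n) * t (Suc n) i\<bar>"
        using c0[of "Suc n"] by (simp add: abs_mult)
      ultimately show ?thesis by linarith
    qed
    have "real n + W n \<le> c (Suc n) * S ?M (t (Suc n))" by (rule hump)
    also have "\<dots> = (\<Sum>i<?M. c (Suc n) * \<bar>t (Suc n) i\<bar>)" by (simp add: S_def sum_distrib_left)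
    also have "\<dots> \<le> (\<Sum>i<?M. \<bar>u i\<bar> + (\<Sum>j\<le>n. c j * \<bar>t j i\<bar>) + R)" by (rule sum_mono) (rule pt)
    also have "\<dots> = (\<Sum>i<?M. \<bar>u i\<bar>) + (\<Sum>i<?M. \<Sum>j\<le>n. c j * \<bar>t j i\<bar>) + real ?M * R"
      by (simp add: sum.distrib)
    also have "(\<Sum>i<?M. \<Sum>j\<le>n. c j * \<bar>t j i\<bar>) = (\<Sum>j\<le>n. c j * S ?M (t j))"
      by (subst sum.swap) (simp add: S_def sum_distrib_left)
    also have "\<dots> = (\<Sum>j\<le>n. c j * S (m j) (t j))" by (rule sum.cong[OF refl]) (metis Sm atMost_iff le_SucI)
    finally show ?thesis using Wsum[of n] tail by linarith
  qed
  have "\<not> summable (\<lambda>i. \<bar>u i\<bar>)"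
  proof
    assume s: "summable (\<lambda>i. \<bar>u i\<bar>)"
    obtain n where "(\<Sum>i. \<bar>u i\<bar>) + 2 < real n" using reals_Archimedean2 by blast
    with large[of n] sum_le_suminf[OF s, of "{..<m (Suc n)}"] show False by auto
  qed
  then show ?thesis
    using c0 c_sum tT unfolding u_def by (intro exI[of _ c] exI[of _ t]) (auto simp: less_imp_le)
qed

section \<open>Functionals on Lipschitz functions\<close>

lemma Lip0I:
  assumes "\<And>x. x \<notin> M \<Longrightarrow> f x = 0" "f p = 0" "C-lipschitz_on M f"
  shows "f \<in> Lip0 M p"
  using assms unfolding Lip0_def by blast

lemma Lip0D:
  assumes "f \<in> Lip0 M p"
  shows "x \<notin> M \<Longrightarrow> f x = 0" "f p = 0" "\<exists>C. C-lipschitz_on M f"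
  using assms unfolding Lip0_def by auto

lemma Lip0_zero [simp]: "0 \<in> Lip0 M p"
  by (rule Lip0I[of _ _ _ 0]) (auto simp: lipschitz_on_def)

lemma Lip0_add: "f + g \<in> Lip0 M p" if fg: "f \<in> Lip0 M p" "g \<in> Lip0 M p"
proof -
  obtain C D where "C-lipschitz_on M f" "D-lipschitz_on M g"
    using fg[THEN Lip0D(3)] by blast
  then have "(C + D)-lipschitz_on M (f + g)"
    using lipschitz_on_add[of C M f D g] by (simp add: plus_fun_def)
  then show ?thesis using Lip0D(1,2)[OF fg(1)] Lip0D(1,2)[OF fg(2)] by (intro Lip0I) auto
qed

lemma Lip0_scaleR: "c *\<^sub>R f \<in> Lip0 M p" if f: "f \<in> Lip0 M p"
proof -
  obtain C where "C-lipschitz_on M f" using Lip0D(3)[OF f] by blast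
  then have "(\<bar>c\<bar> * C)-lipschitz_on M (c *\<^sub>R f)"
    using lipschitz_on_cmult[of C M f c] by (simp add: scaleR_fun_def)
  then show ?thesis using Lip0D(1,2)[OF f] by (intro Lip0I) (auto simp: scaleR_fun_def)
qed

lemma lip_norm_bdd: "bdd_above (insert 0 {\<bar>f x - f y\<bar> / dist x y | x y. x \<in> M \<and> y \<in> M \<and> x \<noteq> y})"
  if f: "f \<in> Lip0 M p"
proof -
  obtain C where C: "C-lipschitz_on M f" using Lip0D(3)[OF f] by blast
  show ?thesis
  proof (rule bdd_aboveI[of _ "\<bar>C\<bar>"])
    fix q assume "q \<in> insert 0 {\<bar>f x - f y\<bar> / dist x y | x y. x \<in> M \<and> y \<in> M \<and> x \<noteq> y}"
    then show "q \<le> \<bar>C\<bar>"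
      using lipschitz_onD[OF C] by (auto simp: dist_real_def divide_le_eq) (smt (verit) mult_right_mono zero_le_dist)
  qed
qed

lemma lip_norm_nonneg: "0 \<le> lip_norm M f" if "f \<in> Lip0 M p"
  unfolding lip_norm_def by (rule cSup_upper[OF _ lip_norm_bdd[OF that]]) simp

lemma lip_norm_bound: "\<bar>f x - f y\<bar> \<le> lip_norm M f * dist x y"
  if f: "f \<in> Lip0 M p" and "x \<in> M" "y \<in> M"
proof (cases "x = y")
  case False
  have "\<bar>f x - f y\<bar> / dist x y \<le> lip_norm M f"
    unfolding lip_norm_def
    by (rule cSup_upper[OF _ lip_norm_bdd[OF f]]) (use False that in blast)
  then show ?thesis using False by (simp add: divide_le_eq)
qed simp

lemma lip_norm_zero [simp]: "lip_norm M 0 = 0"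
proof -
  have "insert 0 {\<bar>(0::'a \<Rightarrow> real) x - 0 y\<bar> / dist x y | x y. x \<in> M \<and> y \<in> M \<and> x \<noteq> y} = {0}"
    by auto
  then show ?thesis unfolding lip_norm_def by (simp only: cSup_singleton)
qed

lemma Lip0_dualI:
  assumes "\<And>f. f \<notin> Lip0 M p \<Longrightarrow> \<phi> f = 0"
    and "\<And>f g. f \<in> Lip0 M p \<Longrightarrow> g \<in> Lip0 M p \<Longrightarrow> \<phi> (f + g) = \<phi> f + \<phi> g"
    and "\<And>c f. f \<in> Lip0 M p \<Longrightarrow> \<phi> (c *\<^sub>R f) = c * \<phi> f"
    and "\<And>f. f \<in> Lip0 M p \<Longrightarrow> \<bar>\<phi> f\<bar> \<le> C * lip_norm M f"
  shows "\<phi> \<in> Lip0_dual M p"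
  using assms unfolding Lip0_dual_def by blast

lemma Lip0_dualD:
  assumes "\<phi> \<in> Lip0_dual M p"
  shows "f \<notin> Lip0 M p \<Longrightarrow> \<phi> f = 0"
    "f \<in> Lip0 M p \<Longrightarrow> g \<in> Lip0 M p \<Longrightarrow> \<phi> (f + g) = \<phi> f + \<phi> g"
    "f \<in> Lip0 M p \<Longrightarrow> \<phi> (c *\<^sub>R f) = c * \<phi> f"
    "\<exists>C. \<forall>f\<in>Lip0 M p. \<bar>\<phi> f\<bar> \<le> C * lip_norm M f"
  using assms unfolding Lip0_dual_def by auto

lemma subspace_Lip0_dual: "subspace (Lip0_dual M p)"
proof (rule subspaceI)
  show "0 \<in> Lip0_dual M p" by (rule Lip0_dualI[of _ _ _ 0]) auto
next
  fix \<phi> \<psi> assume *: "\<phi> \<in> Lip0_dual M p" "\<psi> \<in> Lip0_dual M p"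
  obtain C D where CD: "\<And>f. f \<in> Lip0 M p \<Longrightarrow> \<bar>\<phi> f\<bar> \<le> C * lip_norm M f"
     "\<And>f. f \<in> Lip0 M p \<Longrightarrow> \<bar>\<psi> f\<bar> \<le> D * lip_norm M f"
    using *[THEN Lip0_dualD(4)] by blast
  show "\<phi> + \<psi> \<in> Lip0_dual M p"
  proof (rule Lip0_dualI[of _ _ _ "C + D"])
    fix f assume "f \<in> Lip0 M p"
    then show "\<bar>(\<phi> + \<psi>) f\<bar> \<le> (C + D) * lip_norm M f"
      using CD[of f] by (simp add: distrib_right)
  qed (use *[THEN Lip0_dualD(1)] *[THEN Lip0_dualD(2)] *[THEN Lip0_dualD(3)]
       in \<open>auto simp: algebra_simps\<close>)
next
  fix c \<phi> assume *: "\<phi> \<in> Lip0_dual M p"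
  obtain C where C: "\<And>f. f \<in> Lip0 M p \<Longrightarrow> \<bar>\<phi> f\<bar> \<le> C * lip_norm M f"
    using *[THEN Lip0_dualD(4)] by blast
  show "c *\<^sub>R \<phi> \<in> Lip0_dual M p"
  proof (rule Lip0_dualI[of _ _ _ "\<bar>c\<bar> * C"])
    fix f assume "f \<in> Lip0 M p"
    from mult_left_mono[OF C[OF this], of "\<bar>c\<bar>"]
    show "\<bar>(c *\<^sub>R \<phi>) f\<bar> \<le> \<bar>c\<bar> * C * lip_norm M f"
      by (simp add: scaleR_fun_def abs_mult mult.assoc)
  qed (use Lip0_dualD(1-3)[OF *] in \<open>auto simp: scaleR_fun_def algebra_simps\<close>)
qed

text \<open>
  The supremum in \<^const>\<open>dual_norm\<close> is over an arbitrary set of reals, hence meaningful only for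
  functionals that are bounded on the unit ball; membership in \<^const>\<open>Lip0_dual\<close> provides this.
\<close>

lemma dual_norm_bound:
  assumes \<phi>: "\<phi> \<in> Lip0_dual M p" and f: "f \<in> Lip0 M p"
  shows "\<bar>\<phi> f\<bar> \<le> dual_norm M p \<phi> * lip_norm M f"
proof -
  obtain C where C: "\<And>f. f \<in> Lip0 M p \<Longrightarrow> \<bar>\<phi> f\<bar> \<le> C * lip_norm M f"
    using Lip0_dualD(4)[OF \<phi>] by blast
  have bdd: "bdd_above {\<bar>\<phi> f\<bar> | f. f \<in> Lip0 M p \<and> lip_norm M f \<le> 1}"
  proof (rule bdd_aboveI[of _ "\<bar>C\<bar>"], safe)
    fix f assume f: "f \<in> Lip0 M p" "lip_norm M f \<le> 1"
    have "\<bar>\<phi> f\<bar> \<le> \<bar>C\<bar> * lip_norm M f"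
      using C[OF f(1)] lip_norm_nonneg[OF f(1)] by (smt (verit) mult_right_mono)
    also have "\<dots> \<le> \<bar>C\<bar>" using f lip_norm_nonneg[OF f(1)] by (simp add: mult_left_le)
    finally show "\<bar>\<phi> f\<bar> \<le> \<bar>C\<bar>" .
  qed
  show ?thesis
  proof (cases "lip_norm M f = 0")
    case True
    then show ?thesis using C[OF f] by simp
  next
    case False
    then have pos: "0 < lip_norm M f" using lip_norm_nonneg[OF f] by simp
    define c where "c = 1 / lip_norm M f"
    have g: "c *\<^sub>R f \<in> Lip0 M p" by (rule Lip0_scaleR[OF f])
    have "lip_norm M (c *\<^sub>R f) \<le> 1" unfolding lip_norm_def
    proof (rule cSup_least, simp, safe)
      fix x y assume "x \<in> M" "y \<in> M" "x \<noteq> y"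
      then have "c * \<bar>f x - f y\<bar> \<le> dist x y"
        using lip_norm_bound[OF f, of x y] pos by (simp add: c_def field_simps)
      moreover have "(c *\<^sub>R f) x - (c *\<^sub>R f) y = c * (f x - f y)"
        by (simp add: scaleR_fun_def right_diff_distrib)
      then have "\<bar>(c *\<^sub>R f) x - (c *\<^sub>R f) y\<bar> = c * \<bar>f x - f y\<bar>"
        using pos by (simp add: c_def abs_mult)
      ultimately show "\<bar>(c *\<^sub>R f) x - (c *\<^sub>R f) y\<bar> / dist x y \<le> 1"
        using \<open>x \<noteq> y\<close> by simp
    qed simp
    then have "\<bar>\<phi> (c *\<^sub>R f)\<bar> \<le> dual_norm M p \<phi>"
      unfolding dual_norm_def using g by (intro cSup_upper[OF _ bdd]) blast
    then have "c * \<bar>\<phi> f\<bar> \<le> dual_norm M p \<phi>"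
      using Lip0_dualD(3)[OF \<phi> f, of c] pos by (simp add: c_def abs_mult)
    then show ?thesis using pos by (simp add: c_def divide_le_eq)
  qed
qed

lemma dual_norm_le:
  assumes "\<And>f. f \<in> Lip0 M p \<Longrightarrow> \<bar>\<phi> f\<bar> \<le> C * lip_norm M f" and "0 \<le> C"
  shows "dual_norm M p \<phi> \<le> C"
  unfolding dual_norm_def
proof (rule cSup_least)
  have "0 \<in> Lip0 M p \<and> lip_norm M (0 :: 'a \<Rightarrow> real) \<le> 1" by simp
  then show "{\<bar>\<phi> f\<bar> | f. f \<in> Lip0 M p \<and> lip_norm M f \<le> 1} \<noteq> {}" by blast
next
  fix q assume "q \<in> {\<bar>\<phi> f\<bar> | f. f \<in> Lip0 M p \<and> lip_norm M f \<le> 1}"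
  then obtain f where f: "q = \<bar>\<phi> f\<bar>" "f \<in> Lip0 M p" "lip_norm M f \<le> 1" by blast
  then have "q \<le> C * lip_norm M f" using assms by simp
  also have "\<dots> \<le> C" using f assms by (simp add: mult_left_le)
  finally show "q \<le> C" .
qed

text \<open>
  Evaluation at a Lipschitz function is continuous on the free space, so norm convergent expansions
  turn into convergent series of reals.
\<close>

lemma series_sums_eval:
  assumes e: "range e \<subseteq> Lip0_dual M p" and y: "y \<in> Lip0_dual M p"
    and sums: "series_sums (dual_norm M p) (\<lambda>i. a i *\<^sub>R e i) y" and f: "f \<in> Lip0 M p"
  shows "(\<lambda>i. (a i *\<^sub>R e i) f) sums y f"
proof -
  let ?r = "\<lambda>n. y - (\<Sum>i<n. a i *\<^sub>R e i)"
  note sub = subspace_Lip0_dual[of M p]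
  have r: "?r n \<in> Lip0_dual M p" for n
    using e y by (intro subspace_diff[OF sub] subspace_sum[OF sub] subspace_scale[OF sub]) auto
  have "(\<lambda>n. dual_norm M p (?r n)) \<longlonglongrightarrow> 0" using sums unfolding series_sums_def .
  then have "(\<lambda>n. dual_norm M p (?r n) * lip_norm M f) \<longlonglongrightarrow> 0"
    by (rule tendsto_mult_left_zero)
  then have "(\<lambda>n. ?r n f) \<longlonglongrightarrow> 0"
    by (rule Lim_null_comparison[rotated]) (simp add: dual_norm_bound[OF r f] del: minus_apply)
  moreover have "(\<Sum>i<n. a i *\<^sub>R e i) f = (\<Sum>i<n. (a i *\<^sub>R e i) f)" for n
    by (induction n) auto
  ultimately have "(\<lambda>n. y f - (\<Sum>i<n. (a i *\<^sub>R e i) f)) \<longlonglongrightarrow> 0" by simp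
  from tendsto_diff[OF tendsto_const[of "y f"] this] show ?thesis by (simp add: sums_def)
qed

lemma lip_free_sub_dual: "lip_free M p \<subseteq> Lip0_dual M p"
  unfolding lip_free_def by blast

text \<open>
  Differences of evaluations at points of distance at most \<open>R\<close> have norm at most \<open>R\<close>, so the gliding
  hump can be carried out with them inside the free space.
\<close>

lemma molecule_series_in_lip_free:
  assumes xy: "\<And>k. x k \<in> M" "\<And>k. y k \<in> M" "\<And>k. dist (x k) (y k) \<le> R"
    and c: "\<And>k. 0 \<le> c k" "summable c"
  shows "(\<lambda>f. if f \<in> Lip0 M p then \<Sum>k. c k * (f (x k) - f (y k)) else 0) \<in> lip_free M p"
    (is "?u \<in> _")
proof -
  have R: "0 \<le> R" using xy(3)[of 0] zero_le_dist order_trans by blast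
  have le: "\<bar>c k * (f (x k) - f (y k))\<bar> \<le> (R * lip_norm M f) * c k" if f: "f \<in> Lip0 M p" for f k
  proof -
    have "\<bar>f (x k) - f (y k)\<bar> \<le> lip_norm M f * R"
      using lip_norm_bound[OF f xy(1,2)] lip_norm_nonneg[OF f] xy(3)[of k]
      by (meson mult_left_mono order_trans)
    then show ?thesis using c(1)[of k] by (simp add: abs_mult mult.commute mult_left_mono)
  qed
  have sabs: "summable (\<lambda>k. \<bar>c k * (f (x k) - f (y k))\<bar>)" if f: "f \<in> Lip0 M p" for f
    by (rule summable_comparison_test'[OF summable_mult[OF c(2), of "R * lip_norm M f"], of 0])
       (use le[OF f] in auto)
  have s: "summable (\<lambda>k. c k * (f (x k) - f (y k)))" if "f \<in> Lip0 M p" for f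
    by (rule summable_rabs_cancel[OF sabs[OF that]])
  have tail: "\<bar>\<Sum>k. c (k + n) * (f (x (k + n)) - f (y (k + n)))\<bar> \<le> (R * (\<Sum>k. c (k + n))) * lip_norm M f"
    if f: "f \<in> Lip0 M p" for f n
  proof -
    have "\<bar>\<Sum>k. c (k + n) * (f (x (k + n)) - f (y (k + n)))\<bar> \<le>
        (\<Sum>k. \<bar>c (k + n) * (f (x (k + n)) - f (y (k + n)))\<bar>)"
      by (rule summable_rabs[OF summable_ignore_initial_segment[OF sabs[OF f]]])
    also have "\<dots> \<le> (\<Sum>k. (R * lip_norm M f) * c (k + n))"
      by (rule suminf_le[OF le[OF f] summable_ignore_initial_segment[OF sabs[OF f]]
            summable_mult[OF summable_ignore_initial_segment[OF c(2)]]])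
    also have "\<dots> = R * lip_norm M f * (\<Sum>k. c (k + n))"
      by (rule suminf_mult[OF summable_ignore_initial_segment[OF c(2)]])
    finally show ?thesis by (simp add: mult_ac)
  qed
  have u: "?u \<in> Lip0_dual M p"
  proof (rule Lip0_dualI[of _ _ _ "R * (\<Sum>k. c k)"])
    fix f g assume fg: "f \<in> Lip0 M p" "g \<in> Lip0 M p"
    show "?u (f + g) = ?u f + ?u g"
      using fg Lip0_add[OF fg] suminf_add[OF s[OF fg(1)] s[OF fg(2)]] by (simp add: algebra_simps)
  next
    fix a f assume f: "f \<in> Lip0 M p"
    show "?u (a *\<^sub>R f) = a * ?u f"
      using f Lip0_scaleR[OF f] suminf_mult[OF s[OF f], of a]
      by (simp add: scaleR_fun_def algebra_simps)
  next
    fix f assume f: "f \<in> Lip0 M p"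
    then show "\<bar>?u f\<bar> \<le> R * (\<Sum>k. c k) * lip_norm M f" using tail[OF f, of 0] by simp
  qed simp
  have "\<exists>\<psi>\<in>span (point_eval M p ` M). dual_norm M p (?u - \<psi>) < \<epsilon>" if "\<epsilon> > 0" for \<epsilon>
  proof -
    have "(\<lambda>n. R * (\<Sum>k. c (k + n))) \<longlonglongrightarrow> R * 0"
      by (intro tendsto_mult tendsto_const suminf_exist_split2 c(2))
    then have "eventually (\<lambda>n. R * (\<Sum>k. c (k + n)) < \<epsilon>) sequentially"
      using that by (intro order_tendstoD(2)) auto
    then obtain n where n: "R * (\<Sum>k. c (k + n)) < \<epsilon>" by (auto simp: eventually_sequentially)
    define \<psi> where "\<psi> = (\<Sum>k<n. c k *\<^sub>R (point_eval M p (x k) - point_eval M p (y k)))"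
    have "\<psi> \<in> span (point_eval M p ` M)" unfolding \<psi>_def
      by (intro span_sum span_scale span_diff span_base imageI xy)
    moreover have "dual_norm M p (?u - \<psi>) \<le> R * (\<Sum>k. c (k + n))"
    proof (rule dual_norm_le)
      fix f assume f: "f \<in> Lip0 M p"
      have "(\<Sum>k<m. c k *\<^sub>R (point_eval M p (x k) - point_eval M p (y k))) f
          = (\<Sum>k<m. c k * (f (x k) - f (y k)))" for m
        using f by (induction m) (auto simp: scaleR_fun_def point_eval_def)
      then have "(?u - \<psi>) f = (\<Sum>k. c (k + n) * (f (x (k + n)) - f (y (k + n))))"
        using f suminf_split_initial_segment[OF s[OF f], of n] by (simp add: \<psi>_def)
      then show "\<bar>(?u - \<psi>) f\<bar> \<le> R * (\<Sum>k. c (k + n)) * lip_norm M f"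
        using tail[OF f, of n] by simp
    next
      show "0 \<le> R * (\<Sum>k. c (k + n))"
        by (intro mult_nonneg_nonneg R suminf_nonneg summable_ignore_initial_segment c)
    qed
    ultimately show ?thesis using n by (meson order_le_less_trans)
  qed
  with u show ?thesis unfolding lip_free_def by blast
qed

section \<open>The tree of a system of commuting retractions\<close>

text \<open>
  Such a system of retractions is a rooted tree on \<open>M\<close>. The parent of \<open>\<mu> (Suc n)\<close> is
  \<open>r n (\<mu> (Suc n))\<close>, which has a smaller index, and \<open>r n x\<close> is the first vertex with index at most
  \<open>n\<close> on the way from \<open>x\<close> up to the root. Hence \<open>x\<close> lies below \<open>\<mu> n\<close> exactly when
  \<open>r n x = \<mu> n\<close>.
\<close>

locale commuting_retractions =
  fixes M :: "'a::metric_space set" and p :: 'a and \<mu> :: "nat \<Rightarrow> 'a" and r :: "nat \<Rightarrow> 'a \<Rightarrow> 'a"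
  assumes inj_mu: "inj \<mu>" and range_mu: "range \<mu> = M" and mu_0: "\<mu> 0 = p"
    and r_image: "r n ` M = \<mu> ` {..n}"
    and r_retraction: "retraction_on M (r n)"
    and r_inner: "n \<le> m \<Longrightarrow> x \<in> M \<Longrightarrow> r n (r m x) = r n x"
begin

definition descendants :: "nat \<Rightarrow> 'a set"
  where "descendants n = {x \<in> M. r n x = \<mu> n}"

definition depth :: "'a \<Rightarrow> nat"
  where "depth x = card {i. 0 < i \<and> x \<in> descendants i}"

lemma mu_in [simp]: "\<mu> n \<in> M"
  using range_mu by blast

lemma r_in: "x \<in> M \<Longrightarrow> r n x \<in> M"
  using r_image[of n] range_mu by blast

lemma r_mu: "r n (\<mu> j) = \<mu> j" if "j \<le> n"
proof -
  have "\<mu> j \<in> r n ` M" using that unfolding r_image by blast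
  then show ?thesis using r_retraction[of n] unfolding retraction_on_def by blast
qed

lemma r_mu_index: "x \<in> M \<Longrightarrow> \<exists>j\<le>n. r n x = \<mu> j"
  using r_image[of n] by blast

lemma mu_eq_iff [simp]: "\<mu> i = \<mu> j \<longleftrightarrow> i = j"
  using inj_mu by (simp add: inj_eq)

lemma r_Suc_cases:
  assumes x: "x \<in> M"
  shows "r n x = (if x \<in> descendants (Suc n) then r n (\<mu> (Suc n)) else r (Suc n) x)"
proof (cases "x \<in> descendants (Suc n)")
  case True
  then have "r n x = r n (\<mu> (Suc n))"
    using r_inner[of n "Suc n" x] x by (simp add: descendants_def)
  with True show ?thesis by simp
next
  case False
  obtain j where j: "j \<le> Suc n" "r (Suc n) x = \<mu> j" using r_mu_index[OF x] by blast
  moreover have "j \<noteq> Suc n" using False j x by (auto simp: descendants_def)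
  ultimately show ?thesis using False r_mu[of j n] r_inner[of n "Suc n" x] x by simp
qed

lemma mu_descendants: "\<mu> n \<in> descendants n"
  by (simp add: descendants_def r_mu)

lemma not_descendant_lower: "j < n \<Longrightarrow> \<mu> j \<notin> descendants n"
  by (simp add: descendants_def r_mu)

lemma root_not_descendant: "0 < n \<Longrightarrow> p \<notin> descendants n"
  using not_descendant_lower[of 0 n] mu_0 by simp

lemma finite_ancestors: "finite {i. x \<in> descendants i}"
proof (cases "x \<in> M")
  case True
  then obtain m where "x = \<mu> m" using range_mu by blast
  then have "{i. x \<in> descendants i} \<subseteq> {..m}"
    using not_descendant_lower not_le by blast
  then show ?thesis using finite_subset by blast
qed (simp add: descendants_def)

lemma descendants_mono:
  assumes "x \<in> descendants m" "x \<in> descendants n" "n \<le> m"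
  shows "descendants m \<subseteq> descendants n"
proof
  fix y assume y: "y \<in> descendants m"
  have "r n y = r n (r m y)" using r_inner[of n m y] y assms by (simp add: descendants_def)
  also have "\<dots> = r n (r m x)" using y assms by (simp add: descendants_def)
  also have "\<dots> = \<mu> n" using r_inner[of n m x] assms by (simp add: descendants_def)
  finally show "y \<in> descendants n" using y by (simp add: descendants_def)
qed

lemma depth_mu_Suc: "depth (\<mu> (Suc n)) = Suc (depth (r n (\<mu> (Suc n))))"
proof -
  let ?q = "r n (\<mu> (Suc n))"
  obtain j where j: "j \<le> n" "?q = \<mu> j" using r_mu_index[of "\<mu> (Suc n)" n] by auto
  have "\<mu> (Suc n) \<in> descendants i \<longleftrightarrow> i = Suc n \<or> ?q \<in> descendants i" for i
  proof (cases "i \<le> n")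
    case True
    then show ?thesis
      using r_inner[of i n "\<mu> (Suc n)"] by (auto simp: descendants_def r_in)
  next
    case False
    then consider "i = Suc n" | "Suc n < i" by linarith
    then show ?thesis
      using j not_descendant_lower[of j i] not_descendant_lower[of "Suc n" i] mu_descendants[of i]
      by cases simp_all
  qed
  then have "{i. 0 < i \<and> \<mu> (Suc n) \<in> descendants i}
      = insert (Suc n) {i. 0 < i \<and> ?q \<in> descendants i}" by auto
  moreover have "?q \<notin> descendants (Suc n)" using j not_descendant_lower[of j "Suc n"] by simp
  moreover have "finite {i. 0 < i \<and> ?q \<in> descendants i}"
    by (rule finite_subset[OF _ finite_ancestors[of ?q]]) blast
  ultimately show ?thesis by (simp add: depth_def)
qed

lemma depth_root: "depth p = 0"
proof -
  have "{i. 0 < i \<and> p \<in> descendants i} = {}" using root_not_descendant by blast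
  then show ?thesis unfolding depth_def by (simp only: card.empty)
qed

text \<open>
  Composition with the next retraction changes a function by a multiple of an indicator function: on
  the descendants of \<open>\<mu> (Suc n)\<close>, the value at the parent is replaced by the value at \<open>\<mu> (Suc n)\<close>.
\<close>

lemma comp_r_Suc:
  fixes f :: "'a \<Rightarrow> real"
  assumes "x \<in> M"
  shows "f (r (Suc n) x) =
    f (r n x) + (f (\<mu> (Suc n)) - f (r n (\<mu> (Suc n)))) * indicator (descendants (Suc n)) x"
  using r_Suc_cases[OF assms, of n] by (auto simp: descendants_def indicator_def)

text \<open>
  As \<open>i\<close> decreases from \<open>m\<close> to \<open>n\<close>, the point \<open>r i x\<close> climbs the tree, and it moves by one edge exactly
  when it passes an ancestor of \<open>x\<close>; the sum counts these ancestors.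
\<close>

lemma ancestor_chain_bound:
  assumes step: "\<And>n. dist (\<mu> (Suc n)) (r n (\<mu> (Suc n))) \<le> D"
    and x: "x \<in> M" and nm: "n \<le> m"
  shows "dist (r m x) (r n x) \<le> D * (\<Sum>i\<in>{n..<m}. indicator (descendants (Suc i)) x)"
  using nm
proof (induction m rule: dec_induct)
  case (step m)
  have "dist (r (Suc m) x) (r m x) \<le> D * indicator (descendants (Suc m)) x"
    using r_Suc_cases[OF x, of m] assms(1)[of m] by (auto simp: descendants_def)
  then have "dist (r (Suc m) x) (r n x) \<le> D * indicator (descendants (Suc m)) x + dist (r m x) (r n x)"
    using dist_triangle[of "r (Suc m) x" "r n x" "r m x"] by linarith
  then show ?case using step by (simp add: distrib_left)
qed simp

end

section \<open>Unconditional retractional bases\<close>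

text \<open>
  The index of \<open>e\<close> starts at 0 whereas \<open>\<mu> 0\<close> is the root, so \<open>e n\<close> belongs to the vertex
  \<open>\<mu> (Suc n)\<close>.
\<close>
locale retractional_free_basis = commuting_retractions M p \<mu> r
  for M :: "'a::metric_space set" and p \<mu> r +
  fixes \<alpha> :: real and e :: "nat \<Rightarrow> ('a \<Rightarrow> real) \<Rightarrow> real"
  assumes alpha_pos: "0 < \<alpha>"
    and separated: "x \<in> M \<Longrightarrow> y \<in> M \<Longrightarrow> x \<noteq> y \<Longrightarrow> \<alpha> \<le> dist x y"
    and basis: "schauder_basis (lip_free M p) (dual_norm M p) e"
    and basis_proj_eq: "1 \<le> n \<Longrightarrow> f \<in> Lip0 M p \<Longrightarrow> \<phi> \<in> lip_free M p \<Longrightarrow>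
        basis_proj (dual_norm M p) e n \<phi> f = \<phi> (\<lambda>x. if x \<in> M then f (r n x) else 0)"
begin

lemma root_in: "p \<in> M"
  using mu_in[of 0] mu_0 by simp

text \<open>
  In a uniformly separated space, every bounded function is Lipschitz. Therefore all indicator
  functions, however scattered their sets, are available as test functions.
\<close>

lemma bounded_in_Lip0:
  assumes out: "\<And>x. x \<notin> M \<Longrightarrow> f x = 0" and root: "f p = 0"
    and bdd: "\<And>x. x \<in> M \<Longrightarrow> \<bar>f x\<bar> \<le> (B::real)"
  shows "f \<in> Lip0 M p"
proof (rule Lip0I)
  have B: "0 \<le> B" using bdd[OF root_in] by linarith
  show "(2 * B / \<alpha>)-lipschitz_on M f"
  proof (rule lipschitz_onI)
    fix x y assume xy: "x \<in> M" "y \<in> M"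
    show "dist (f x) (f y) \<le> 2 * B / \<alpha> * dist x y"
    proof (cases "x = y")
      case False
      have "dist (f x) (f y) \<le> 2 * B" using bdd[OF xy(1)] bdd[OF xy(2)] by (simp add: dist_real_def)
      also have "\<dots> = 2 * B / \<alpha> * \<alpha>" using alpha_pos by simp
      also have "\<dots> \<le> 2 * B / \<alpha> * dist x y"
        using separated[OF xy False] B alpha_pos by (intro mult_left_mono) auto
      finally show ?thesis .
    qed simp
  qed (use B alpha_pos in simp)
qed (use out root in auto)

lemma indicator_descendants_Lip0: "(indicator (descendants (Suc n)) :: 'a \<Rightarrow> real) \<in> Lip0 M p"
proof (rule bounded_in_Lip0[where B = 1])
  show "indicator (descendants (Suc n)) x = (0::real)" if "x \<notin> M" for x
    using that by (simp add: descendants_def)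
qed (simp_all add: root_not_descendant indicator_def)

lemma basis_in_dual: "range e \<subseteq> Lip0_dual M p"
  using basis lip_free_sub_dual unfolding schauder_basis_def by blast

text \<open>
  The \<open>n\<close>-th term of the expansion of \<open>\<phi>\<close> is the difference of two consecutive canonical
  projections, so \<open>comp_r_Suc\<close> computes it: up to scaling, \<open>e n\<close> is the edge from \<open>\<mu> (Suc n)\<close> to its
  parent, and the coefficient at this edge is \<open>\<phi>\<close> at the indicator function of the descendants.
\<close>

lemma basis_term_eval:
  assumes f: "f \<in> Lip0 M p" and bdd: "\<And>x. x \<in> M \<Longrightarrow> \<bar>f x\<bar> \<le> B" and \<phi>: "\<phi> \<in> lip_free M p"
  shows "(basis_coeff (dual_norm M p) e \<phi> n *\<^sub>R e n) f =
    (f (\<mu> (Suc n)) - f (r n (\<mu> (Suc n)))) * \<phi> (indicator (descendants (Suc n)))"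
proof -
  let ?c = "basis_coeff (dual_norm M p) e \<phi>"
  let ?P = "\<lambda>n. basis_proj (dual_norm M p) e n \<phi>"
  let ?f = "\<lambda>n x. if x \<in> M then f (r n x) else 0"
  let ?d = "f (\<mu> (Suc n)) - f (r n (\<mu> (Suc n)))"
  let ?I = "indicator (descendants (Suc n)) :: 'a \<Rightarrow> real"
  have \<phi>': "\<phi> \<in> Lip0_dual M p" using \<phi> lip_free_sub_dual by blast
  have fr: "?f n \<in> Lip0 M p" for n
    by (rule bounded_in_Lip0[where B = B])
       (use bdd r_in r_mu[of 0 n] mu_0 Lip0D(2)[OF f] in auto)
  have proj: "?P n f = \<phi> (?f n)" for n
  proof (cases "n = 0")
    case True
    \<comment> \<open>The adjoint formula is given for positive \<open>n\<close> only, but \<open>r 0\<close> is constantly the root.\<close>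
    have "?f 0 = 0"
      using r_mu_index[of _ 0] mu_0 Lip0D(2)[OF f] by (fastforce simp: fun_eq_iff)
    moreover have "\<phi> 0 = 0" using Lip0_dualD(3)[OF \<phi>' Lip0_zero, of 0] by simp
    ultimately show ?thesis using True by (simp only: basis_proj_def) simp
  qed (use basis_proj_eq f \<phi> in simp)
  have "(?c n *\<^sub>R e n) f = ?P (Suc n) f - ?P n f"
    by (simp add: basis_proj_def)
  also have "\<dots> = \<phi> (?f (Suc n)) - \<phi> (?f n)" by (simp add: proj)
  also have "?f (Suc n) = ?f n + ?d *\<^sub>R ?I"
  proof (rule ext)
    fix x
    show "?f (Suc n) x = (?f n + ?d *\<^sub>R ?I) x"
    proof (cases "x \<in> M")
      case True
      then show ?thesis using comp_r_Suc[OF True, of f n] by (simp add: scaleR_fun_def)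
    qed (simp add: scaleR_fun_def descendants_def)
  qed
  also have "\<phi> \<dots> - \<phi> (?f n) = ?d * \<phi> ?I"
    using Lip0_dualD(2)[OF \<phi>' fr Lip0_scaleR[OF indicator_descendants_Lip0]]
      Lip0_dualD(3)[OF \<phi>' indicator_descendants_Lip0] by simp
  finally show ?thesis .
qed

text \<open>
  The parity of the depth differs at the two ends of every edge, so a single test function takes
  values of modulus 1 at all edges simultaneously. Evaluated at it, unconditional convergence makes the
  coefficients absolutely summable, as they are for the unit vector basis of \<open>\<ell>\<^sub>1\<close>.
\<close>

lemma unconditional_imp_summable:
  assumes uncond: "unconditional_basis (lip_free M p) (dual_norm M p) e"
    and \<phi>: "\<phi> \<in> lip_free M p"
  shows "summable (\<lambda>i. \<bar>\<phi> (indicator (descendants (Suc i)))\<bar>)"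
proof -
  define f :: "'a \<Rightarrow> real" where "f x = (if x \<in> M \<and> odd (depth x) then 1 else 0)" for x
  let ?c = "basis_coeff (dual_norm M p) e \<phi>"
  have f: "f \<in> Lip0 M p"
    by (rule bounded_in_Lip0[where B = 1]) (auto simp: f_def depth_root)
  have "\<bar>f (\<mu> (Suc i)) - f (r i (\<mu> (Suc i)))\<bar> = 1" for i
    by (simp add: f_def depth_mu_Suc r_in)
  then have abs_eq: "\<bar>(?c i *\<^sub>R e i) f\<bar> = \<bar>\<phi> (indicator (descendants (Suc i)))\<bar>" for i
    by (subst basis_term_eval[OF f _ \<phi>, where B = 1]) (auto simp: f_def abs_mult)
  have "summable (\<lambda>i. \<bar>(?c i *\<^sub>R e i) f\<bar>)"
  proof (rule summable_abs_if_rearrangements_summable)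
    fix \<pi> :: "nat \<Rightarrow> nat" assume "bij \<pi>"
    then obtain y where "y \<in> lip_free M p"
      and "series_sums (dual_norm M p) (\<lambda>i. ?c (\<pi> i) *\<^sub>R e (\<pi> i)) y"
      using uncond \<phi> unfolding unconditional_basis_def by blast
    then have "(\<lambda>i. (?c (\<pi> i) *\<^sub>R e (\<pi> i)) f) sums y f"
      using basis_in_dual lip_free_sub_dual f
      by (intro series_sums_eval[where e = "\<lambda>i. e (\<pi> i)" and a = "\<lambda>i. ?c (\<pi> i)"]) blast+
    then show "summable (\<lambda>i. (?c (\<pi> i) *\<^sub>R e (\<pi> i)) f)" by (rule sums_summable)
  qed
  then show ?thesis by (simp only: abs_eq)
qed

text \<open>
  For large \<open>n\<close>, the sum counts the edges on the path from \<open>x\<close> to \<open>y\<close> in the tree, which is the \<open>\<ell>\<^sub>1\<close> norm of the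
  coefficients of the difference of the evaluations at \<open>x\<close> and \<open>y\<close>. If points of bounded distance had
  unbounded distance in the tree, then the gliding hump would produce an element of the free space whose
  coefficients are not absolutely summable.
\<close>

lemma unconditional_imp_few_separating_descendants:
  assumes uncond: "unconditional_basis (lip_free M p) (dual_norm M p) e"
  shows "\<exists>L. \<forall>x\<in>M. \<forall>y\<in>M. dist x y \<le> R \<longrightarrow>
    (\<forall>n. (\<Sum>i<n. \<bar>indicator (descendants (Suc i)) x - indicator (descendants (Suc i)) y\<bar>) \<le> (L::real))"
proof (rule ccontr)
  assume no: "\<not> ?thesis"
  define t :: "'a \<Rightarrow> 'a \<Rightarrow> nat \<Rightarrow> real"
    where "t x y i = indicator (descendants (Suc i)) x - indicator (descendants (Suc i)) y" for x y i
  define T where "T = {t x y | x y. x \<in> M \<and> y \<in> M \<and> dist x y \<le> R}"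
  have "\<exists>c s. (\<forall>k. 0 \<le> c k) \<and> summable c \<and> range s \<subseteq> T \<and> \<not> summable (\<lambda>i. \<bar>\<Sum>k. c k * s k i\<bar>)"
  proof (rule gliding_hump)
    fix s assume "s \<in> T"
    then obtain x y where s: "s = t x y" by (auto simp: T_def)
    show "\<bar>s i\<bar> \<le> 1" for i by (simp add: s t_def indicator_def)
    have "{i. s i \<noteq> 0} \<subseteq> Suc -` ({i. x \<in> descendants i} \<union> {i. y \<in> descendants i})"
      by (auto simp: s t_def indicator_def split: if_splits)
    then show "finite {i. s i \<noteq> 0}"
      by (rule finite_subset) (intro finite_vimageI finite_UnI finite_ancestors inj_Suc)
  next
    fix C
    show "\<exists>s\<in>T. \<exists>n. C < (\<Sum>i<n. \<bar>s i\<bar>)"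
    proof -
      obtain x y n where "x \<in> M" "y \<in> M" "dist x y \<le> R" "C < (\<Sum>i<n. \<bar>t x y i\<bar>)"
        using no unfolding t_def by (meson linorder_not_le)
      then show ?thesis unfolding T_def by blast
    qed
  qed
  then obtain c s where c: "\<And>k. 0 \<le> c k" "summable c" and s: "range s \<subseteq> T"
    and div: "\<not> summable (\<lambda>i. \<bar>\<Sum>k. c k * s k i\<bar>)" by blast
  have "\<forall>k. \<exists>x y. s k = t x y \<and> x \<in> M \<and> y \<in> M \<and> dist x y \<le> R"
    using s unfolding T_def by blast
  then obtain x y where xy: "\<And>k. s k = t (x k) (y k)" "\<And>k. x k \<in> M" "\<And>k. y k \<in> M"
      "\<And>k. dist (x k) (y k) \<le> R" by metis
  define u where "u = (\<lambda>f. if f \<in> Lip0 M p then \<Sum>k. c k * (f (x k) - f (y k)) else 0)"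
  have u: "u \<in> lip_free M p"
    unfolding u_def by (rule molecule_series_in_lip_free[OF xy(2-4) c])
  have "u (indicator (descendants (Suc i))) = (\<Sum>k. c k * s k i)" for i
    by (simp only: u_def indicator_descendants_Lip0 if_True xy(1) t_def)
  then show False using div unconditional_imp_summable[OF uncond u] by simp
qed

text \<open>
  If \<open>x\<close> is below \<open>\<mu> n\<close> and \<open>y\<close> is not, then the path from \<open>x\<close> to \<open>y\<close> passes through \<open>\<mu> n\<close>. So the
  part from \<open>x\<close> to \<open>\<mu> n\<close> has boundedly many edges, each of length at most \<open>D\<close>.
\<close>

lemma unconditional_imp_boundary_near_ancestor:
  assumes uncond: "unconditional_basis (lip_free M p) (dual_norm M p) e"
    and step: "\<And>n. dist (\<mu> (Suc n)) (r n (\<mu> (Suc n))) \<le> D"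
  shows "\<exists>C. \<forall>n. \<forall>x\<in>descendants n. \<forall>y\<in>M - descendants n. dist x y \<le> R \<longrightarrow> dist x (\<mu> n) \<le> C"
proof -
  obtain L :: real where L: "\<forall>x\<in>M. \<forall>y\<in>M. dist x y \<le> R \<longrightarrow>
      (\<forall>n. (\<Sum>i<n. \<bar>indicator (descendants (Suc i)) x - indicator (descendants (Suc i)) y\<bar>) \<le> L)"
    using unconditional_imp_few_separating_descendants[OF uncond, of R] ..
  have D: "0 \<le> D" using order_trans[OF zero_le_dist step[of 0]] .
  have "dist x (\<mu> n) \<le> D * L"
    if x: "x \<in> descendants n" and y: "y \<in> M" "y \<notin> descendants n" and "dist x y \<le> R" for n x y
  proof -
    have xM: "x \<in> M" using x by (simp add: descendants_def)
    then obtain m where m: "x = \<mu> m" using range_mu by blast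
    have nm: "n \<le> m" using x not_descendant_lower[of m n] m not_le by blast
    have "(\<Sum>i\<in>{n..<m}. indicator (descendants (Suc i)) x) \<le>
        (\<Sum>i\<in>{n..<m}. \<bar>indicator (descendants (Suc i)) x - indicator (descendants (Suc i)) y :: real\<bar>)"
    proof (rule sum_mono)
      fix i assume i: "i \<in> {n..<m}"
      show "indicator (descendants (Suc i)) x \<le>
          \<bar>indicator (descendants (Suc i)) x - indicator (descendants (Suc i)) y :: real\<bar>"
      proof (cases "x \<in> descendants (Suc i)")
        case True
        then have "y \<notin> descendants (Suc i)" using descendants_mono[OF True x] i y by auto
        then show ?thesis by simp
      qed simp
    qed
    also have "\<dots> \<le> (\<Sum>i<m. \<bar>indicator (descendants (Suc i)) x - indicator (descendants (Suc i)) y\<bar>)"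
      by (rule sum_mono2) auto
    also have "\<dots> \<le> L" by (rule L[rule_format]) (use xM y that in auto)
    finally have chain: "(\<Sum>i\<in>{n..<m}. indicator (descendants (Suc i)) x) \<le> L" .
    have "dist x (\<mu> n) = dist (r m x) (r n x)" using x m r_mu[of m m] by (simp add: descendants_def)
    also have "\<dots> \<le> D * (\<Sum>i\<in>{n..<m}. indicator (descendants (Suc i)) x)"
      by (rule ancestor_chain_bound[OF step xM nm])
    also have "\<dots> \<le> D * L" by (rule mult_left_mono[OF chain D])
    finally show ?thesis .
  qed
  then show ?thesis by (intro exI[of _ "D * L"]) blast
qed

end

section \<open>Large-scale geometry of nets\<close>

lemma independent_pair_exists:
  assumes "dim (UNIV :: 'a::real_vector set) \<ge> 2"
  obtains u w :: "'a::real_vector" where "\<And>a b. a *\<^sub>R u + b *\<^sub>R w = 0 \<Longrightarrow> a = 0 \<and> b = 0"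
proof -
  obtain B :: "'a set" where B: "independent B" "card B = dim (UNIV :: 'a set)"
    by (rule basis_exists[of "UNIV :: 'a set"])
  then have "2 \<le> card B" using assms by simp
  then obtain S where "S \<subseteq> B" "card S = 2" by (meson obtain_subset_with_card_n)
  then obtain u w where uw: "u \<in> B" "w \<in> B" "u \<noteq> w" by (auto simp: card_2_iff)
  have ind: "independent {u, w}" by (rule independent_mono[OF B(1)]) (use uw in simp)
  have "a = 0 \<and> b = 0" if "a *\<^sub>R u + b *\<^sub>R w = 0" for a b
  proof -
    define c where "c v = (if v = u then a else b)" for v
    have "(\<Sum>v\<in>{u, w}. c v *\<^sub>R v) = 0" using that uw by (simp add: c_def)
    then have "c v = 0" if "v \<in> {u, w}" for v
      using independentD[OF ind, of "{u, w}" c v] that by simp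
    from this[of u] this[of w] show ?thesis using uw by (simp add: c_def)
  qed
  then show ?thesis using that by blast
qed

text \<open>
  All norms on a plane are equivalent; compactness of the Euclidean unit circle yields the constant.
\<close>

lemma independent_pair_norm_lower_bound:
  fixes u w :: "'a::real_normed_vector"
  assumes ind: "\<And>a b. a *\<^sub>R u + b *\<^sub>R w = 0 \<Longrightarrow> a = 0 \<and> b = 0"
  obtains \<kappa> where "0 < \<kappa>" "\<And>a b. \<kappa> * \<bar>a\<bar> \<le> norm (a *\<^sub>R u + b *\<^sub>R w)"
    "\<And>a b. \<kappa> * \<bar>b\<bar> \<le> norm (a *\<^sub>R u + b *\<^sub>R w)"
proof -
  define g where "g = (\<lambda>q :: real \<times> real. norm (fst q *\<^sub>R u + snd q *\<^sub>R w))"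
  let ?S = "sphere (0 :: real \<times> real) 1"
  have "(1, 0) \<in> ?S" by (simp add: norm_Pair)
  moreover have "continuous_on ?S g" unfolding g_def by (intro continuous_intros)
  ultimately obtain q where q: "q \<in> ?S" "\<And>q'. q' \<in> ?S \<Longrightarrow> g q \<le> g q'"
    using continuous_attains_inf[of ?S g] by (metis compact_sphere empty_iff)
  have "q \<noteq> 0" using q by auto
  then have "g q \<noteq> 0" using ind[of "fst q" "snd q"] by (auto simp: g_def prod_eq_iff)
  then have pos: "0 < g q" by (simp add: g_def less_le)
  have bound: "g q * norm q' \<le> g q'" for q'
  proof (cases "q' = 0")
    case False
    then have "g q \<le> g (q' /\<^sub>R norm q')" by (intro q) simp
    moreover have "fst (q' /\<^sub>R norm q') *\<^sub>R u + snd (q' /\<^sub>R norm q') *\<^sub>R w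
        = (1 / norm q') *\<^sub>R (fst q' *\<^sub>R u + snd q' *\<^sub>R w)"
      by (simp add: scaleR_add_right divide_inverse mult.commute)
    then have "g (q' /\<^sub>R norm q') = g q' / norm q'" by (simp add: g_def)
    ultimately have "g q \<le> g q' / norm q'" by (simp only:)
    then show ?thesis using False by (simp add: pos_le_divide_eq)
  qed (simp add: g_def)
  show ?thesis
  proof (rule that[OF pos])
    fix a b :: real
    have "g q * \<bar>a\<bar> \<le> g q * norm (a, b)" "g q * \<bar>b\<bar> \<le> g q * norm (a, b)"
      using pos norm_fst_le[of a b] norm_snd_le[of b a]
      by (auto intro!: mult_left_mono)
    then show "g q * \<bar>a\<bar> \<le> norm (a *\<^sub>R u + b *\<^sub>R w)" "g q * \<bar>b\<bar> \<le> norm (a *\<^sub>R u + b *\<^sub>R w)"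
      using bound[of "(a, b)"] by (auto simp: g_def)
  qed
qed

text \<open>
  Segments are connected at every scale: among closely spaced points from \<open>z0\<close> to \<open>z1\<close>, there is a
  first one at which \<open>P\<close> fails.
\<close>

lemma segment_crossing:
  fixes z0 z1 :: "'a::real_normed_vector"
  assumes "P z0" "\<not> P z1" "0 < \<epsilon>"
  shows "\<exists>z\<in>closed_segment z0 z1. \<exists>z'. dist z z' \<le> \<epsilon> \<and> P z \<and> \<not> P z'"
proof -
  obtain M :: nat where M: "norm (z1 - z0) / \<epsilon> < real M" using reals_Archimedean2 by blast
  then have M0: "0 < real M" using assms(3) by (smt (verit) divide_nonneg_pos norm_ge_zero)
  define g where "g i = z0 + (real i / real M) *\<^sub>R (z1 - z0)" for i
  have "\<exists>i<M. P (g i) \<and> \<not> P (g (Suc i))"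
  proof (rule ccontr)
    assume no: "\<not> ?thesis"
    have "i \<le> M \<Longrightarrow> P (g i)" for i
      by (induction i) (use no assms(1) in \<open>auto simp: g_def\<close>)
    from this[of M] show False using assms(2) M0 by (simp add: g_def)
  qed
  then obtain i where i: "i < M" "P (g i)" "\<not> P (g (Suc i))" by blast
  have "g (Suc i) - g i = (1 / real M) *\<^sub>R (z1 - z0)"
    by (simp add: g_def add_divide_distrib scaleR_left_distrib)
  then have "dist (g i) (g (Suc i)) = norm ((1 / real M) *\<^sub>R (z1 - z0))"
    by (simp only: dist_norm norm_minus_commute[of "g i"])
  also have "\<dots> = norm (z1 - z0) / real M" by simp
  also have "\<dots> \<le> \<epsilon>" using M M0 assms(3) by (simp add: field_simps)
  finally have "dist (g i) (g (Suc i)) \<le> \<epsilon>" .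
  moreover have "g i \<in> closed_segment z0 z1"
    unfolding closed_segment_def
    using i M0 by (intro CollectI exI[of _ "real i / real M"]) (simp add: g_def algebra_simps)
  ultimately show ?thesis using i by blast
qed

lemma net_nearest_point_map:
  assumes net: "net_in \<alpha> \<beta> UNIV N" and "0 < \<beta>"
  obtains \<nu> where "\<And>z. \<nu> z \<in> N" "\<And>z. dist z (\<nu> z) \<le> 2 * \<beta>" "\<And>z. z \<in> N \<Longrightarrow> \<nu> z = z"
proof -
  have "\<exists>q\<in>N. dist z q \<le> 2 * \<beta>" for z
  proof (rule ccontr)
    assume no: "\<not> ?thesis"
    have ne: "N \<noteq> {}" and le: "infdist z N \<le> \<beta>" using net by (auto simp: net_in_def)
    have "2 * \<beta> \<le> infdist z N"
      unfolding infdist_notempty[OF ne] by (rule cINF_greatest[OF ne]) (use no in force)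
    then show False using le assms(2) by linarith
  qed
  then obtain q where q: "\<And>z. q z \<in> N" "\<And>z. dist z (q z) \<le> 2 * \<beta>" by metis
  show ?thesis
    by (rule that[of "\<lambda>z. if z \<in> N then z else q z"]) (use q assms(2) in auto)
qed

lemma net_crossing:
  fixes N :: "'a::real_normed_vector set"
  assumes \<nu>: "\<And>z. \<nu> z \<in> N" "\<And>z. dist z (\<nu> z) \<le> 2 * \<beta>" and "0 < \<beta>"
    and "\<nu> z0 \<in> A" "\<nu> z1 \<notin> A"
  shows "\<exists>z\<in>closed_segment z0 z1. \<exists>x\<in>N \<inter> A. \<exists>y\<in>N - A. dist z x \<le> 2 * \<beta> \<and> dist x y \<le> 5 * \<beta>"
proof -
  obtain z z' where z: "z \<in> closed_segment z0 z1" "dist z z' \<le> \<beta>" "\<nu> z \<in> A" "\<nu> z' \<notin> A"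
    using segment_crossing[of "\<lambda>z. \<nu> z \<in> A" z0 z1 \<beta>] assms by blast
  have "dist (\<nu> z) (\<nu> z') \<le> dist z (\<nu> z) + dist z z' + dist z' (\<nu> z')"
    using dist_triangle[of "\<nu> z" "\<nu> z'" z] dist_triangle[of z "\<nu> z'" z']
    by (simp add: dist_commute)
  also have "\<dots> \<le> 5 * \<beta>" using z(2) \<nu>(2)[of z] \<nu>(2)[of z'] by linarith
  finally show ?thesis using z \<nu> by blast
qed

text \<open>
  On the way from \<open>\<mu> (Suc n)\<close> to the root, some \<open>x\<close> below \<open>\<mu> (Suc n)\<close> is close to some \<open>y\<close> that is
  not. The retraction \<open>r (Suc n)\<close> sends \<open>x\<close> to \<open>\<mu> (Suc n)\<close> and \<open>r n\<close> sends it to the parent, whereas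
  both send \<open>y\<close> to the same point. As both are Lipschitz, that point is close to \<open>\<mu> (Suc n)\<close> and to
  the parent.
\<close>

lemma parent_distance_bound:
  fixes N :: "'a::real_normed_vector set"
  assumes tree: "commuting_retractions N p \<mu> r"
    and net: "net_in \<alpha> \<beta> UNIV N" "0 < \<beta>"
    and lip: "\<And>n. K-lipschitz_on N (r n)"
  shows "dist (\<mu> (Suc n)) (r n (\<mu> (Suc n))) \<le> 2 * (K * (5 * \<beta>))"
proof -
  interpret commuting_retractions N p \<mu> r by (rule tree)
  obtain \<nu> where \<nu>: "\<And>z. \<nu> z \<in> N" "\<And>z. dist z (\<nu> z) \<le> 2 * \<beta>" "\<And>z. z \<in> N \<Longrightarrow> \<nu> z = z"
    using net_nearest_point_map[OF net] by blast
  let ?A = "descendants (Suc n)"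
  have "\<nu> (\<mu> (Suc n)) \<in> ?A" "\<nu> (\<mu> 0) \<notin> ?A"
    using mu_descendants not_descendant_lower[of 0 "Suc n"] by (simp_all add: \<nu>(3))
  then obtain x y where xy: "x \<in> N" "x \<in> ?A" "y \<in> N" "y \<notin> ?A" "dist x y \<le> 5 * \<beta>"
    using net_crossing[of \<nu> N \<beta> "\<mu> (Suc n)" ?A "\<mu> 0"] \<nu>(1,2) net(2) by blast
  have K: "0 \<le> K" using lip[of 0] by (rule lipschitz_on_nonneg)
  have close: "dist (r i x) (r i y) \<le> K * (5 * \<beta>)" for i
    using lipschitz_onD[OF lip[of i] xy(1,3)] mult_left_mono[OF xy(5) K] by linarith
  have "r (Suc n) x = \<mu> (Suc n)" "r n x = r n (\<mu> (Suc n))" "r n y = r (Suc n) y"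
    using xy r_Suc_cases[of x n] r_Suc_cases[of y n] by (auto simp: descendants_def)
  then show ?thesis
    using close[of n] close[of "Suc n"]
      dist_triangle2[of "\<mu> (Suc n)" "r n (\<mu> (Suc n))" "r n y"] by simp
qed

text \<open>
  This is where the dimension enters: a ball does not separate a plane at large scale. In coordinates
  \<open>J a b\<close> of a plane through the root, take \<open>x\<close> near the far point \<open>J T 0\<close> and climb from \<open>x\<close> to the
  root. The edges are short, so some ancestor \<open>v\<close> of \<open>x\<close> has distance between \<open>\<rho>\<close> and \<open>\<rho> + D\<close> from the
  root. The descendants of \<open>v\<close> contain \<open>x\<close> but not the root, so every path between the two crosses the
  boundary of this set, hence by \<open>near\<close> comes close to \<open>v\<close>. For the straight path this puts \<open>v\<close> near some
  \<open>J t 0\<close> with \<open>t\<close> far from 0 and from \<open>T\<close>. The detour through \<open>J T H\<close> and \<open>J 0 H\<close> with large \<open>H\<close>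
  avoids a neighbourhood of this point, a contradiction.
\<close>

lemma boundaries_not_all_near_ancestors:
  fixes N :: "'a::real_normed_vector set"
  assumes tree: "commuting_retractions N p \<mu> r"
    and dim: "dim (UNIV :: 'a set) \<ge> 2"
    and net: "net_in \<alpha> \<beta> UNIV N" "0 < \<beta>"
    and step: "\<And>n. dist (\<mu> (Suc n)) (r n (\<mu> (Suc n))) \<le> D"
    and near: "\<And>n x y. x \<in> commuting_retractions.descendants N \<mu> r n \<Longrightarrow> y \<in> N \<Longrightarrow>
      y \<notin> commuting_retractions.descendants N \<mu> r n \<Longrightarrow> dist x y \<le> 5 * \<beta> \<Longrightarrow> dist x (\<mu> n) \<le> C"
  shows False
proof -
  interpret commuting_retractions N p \<mu> r by (rule tree)
  obtain \<nu> where \<nu>: "\<And>z. \<nu> z \<in> N" "\<And>z. dist z (\<nu> z) \<le> 2 * \<beta>" "\<And>z. z \<in> N \<Longrightarrow> \<nu> z = z"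
    using net_nearest_point_map[OF net] by blast
  obtain u w :: 'a where ind: "\<And>a b. a *\<^sub>R u + b *\<^sub>R w = 0 \<Longrightarrow> a = 0 \<and> b = 0"
    using independent_pair_exists[OF dim] by blast
  have u0: "0 < norm u" using ind[of 1 0] by auto
  obtain \<kappa> where \<kappa>: "0 < \<kappa>" "\<And>a b. \<kappa> * \<bar>a\<bar> \<le> norm (a *\<^sub>R u + b *\<^sub>R w)"
    "\<And>a b. \<kappa> * \<bar>b\<bar> \<le> norm (a *\<^sub>R u + b *\<^sub>R w)"
    using independent_pair_norm_lower_bound[OF ind] by blast
  define J where "J a b = p + a *\<^sub>R u + b *\<^sub>R w" for a b
  \<comment> \<open>\<open>\<sigma>\<close> bounds the distance of a crossing from \<open>v\<close>. Two points of the plane within \<open>\<sigma>\<close> of \<open>v\<close> have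
        coordinates that differ by at most \<open>s\<close>. The choice of \<open>\<rho>\<close> and \<open>T\<close> makes \<open>t\<close> differ from 0 and
        from \<open>T\<close> by at least \<open>s + 1\<close>.\<close>
  define \<sigma> where "\<sigma> = \<bar>C\<bar> + 2 * \<beta>"
  define s where "s = 2 * \<sigma> / \<kappa>"
  define \<rho> where "\<rho> = \<sigma> + (s + 1) * norm u"
  define T where "T = s + 1 + (\<rho> + D + \<sigma>) / norm u"
  have D: "0 \<le> D" by (rule order_trans[OF zero_le_dist step[of 0]])
  have \<sigma>: "2 * \<beta> \<le> \<sigma>" "0 < \<sigma>" using net(2) by (auto simp: \<sigma>_def)
  have s: "0 \<le> s" using \<sigma> \<kappa>(1) by (simp add: s_def)
  have \<rho>: "0 < \<rho>" using \<sigma> s u0 by (simp add: \<rho>_def add_pos_nonneg)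
  have Tu: "T * norm u = (s + 1) * norm u + \<rho> + D + \<sigma>"
    using u0 by (simp add: T_def field_simps)
  have T: "0 \<le> T" using s \<rho> D \<sigma> by (simp add: T_def)
  define x where "x = \<nu> (J T 0)"
  have x: "x \<in> N" by (simp add: x_def \<nu>)
  obtain m where m: "x = \<mu> m" using x range_mu by blast
  have "dist (J T 0) p = T * norm u" using T by (simp add: J_def dist_norm)
  moreover have "0 \<le> (s + 1) * norm u" using s by simp
  moreover have "dist (J T 0) x \<le> 2 * \<beta>" using \<nu>(2)[of "J T 0"] by (simp add: x_def)
  ultimately have "\<rho> \<le> dist x p"
    using dist_triangle[of "J T 0" p x] Tu D \<sigma> by linarith
  then have "\<rho> \<le> dist (r m x) p" using m r_mu[of m m] by simp
  define n where "n = (LEAST n. \<rho> \<le> dist (r n x) p)"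
  have n: "\<rho> \<le> dist (r n x) p"
    unfolding n_def by (rule LeastI[of "\<lambda>n. \<rho> \<le> dist (r n x) p"]) fact
  have n_least: "dist (r k x) p < \<rho>" if "k < n" for k
    using not_less_Least[OF that[unfolded n_def]] by simp
  have "r 0 x = p" using r_mu_index[OF x, of 0] mu_0 by simp
  then have "n \<noteq> 0" using n \<rho> by (intro notI) simp
  then obtain k where k: "n = Suc k" by (cases n) simp
  have nk: "dist (r k x) p < \<rho>" using n_least k by simp
  let ?v = "\<mu> (Suc k)"
  have xA: "x \<in> descendants (Suc k)"
  proof (rule ccontr)
    assume "x \<notin> descendants (Suc k)"
    then have "r k x = r (Suc k) x" using r_Suc_cases[OF x, of k] by simp
    then show False using nk n k by simp
  qed
  then have v: "r (Suc k) x = ?v" "r k x = r k ?v"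
    using r_Suc_cases[OF x, of k] by (simp_all add: descendants_def)
  have v_far: "\<rho> \<le> dist ?v p" using n k v by simp
  have v_near: "dist ?v p \<le> \<rho> + D"
    using nk v step[of k] dist_triangle[of ?v p "r k ?v"] by simp
  have cross: "\<exists>c\<in>{0..1}. dist (J ((1 - c) * a + c * a') ((1 - c) * b + c * b')) ?v \<le> \<sigma>"
    if AB: "\<nu> (J a b) \<in> descendants (Suc k)" "\<nu> (J a' b') \<notin> descendants (Suc k)" for a b a' b'
  proof -
    obtain z x' y' where z: "z \<in> closed_segment (J a b) (J a' b')" "dist z x' \<le> 2 * \<beta>"
      and xy: "x' \<in> descendants (Suc k)" "y' \<in> N" "y' \<notin> descendants (Suc k)" "dist x' y' \<le> 5 * \<beta>"
      using net_crossing[of \<nu> N \<beta>, OF \<nu>(1,2) net(2) AB] by blast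
    have "dist z ?v \<le> \<sigma>"
      using near[OF xy] z(2) dist_triangle[of z ?v x'] by (simp add: \<sigma>_def)
    moreover obtain c where c: "0 \<le> c" "c \<le> 1" "z = (1 - c) *\<^sub>R J a b + c *\<^sub>R J a' b'"
      using z(1) by (auto simp: in_segment)
    moreover have "z = J ((1 - c) * a + c * a') ((1 - c) * b + c * b')"
      unfolding c(3) J_def by (simp add: algebra_simps)
    ultimately show ?thesis by (intro bexI[of _ c]) simp_all
  qed
  have in_A: "\<nu> (J T 0) \<in> descendants (Suc k)" using xA by (simp add: x_def)
  have "J 0 0 = \<mu> 0" by (simp add: J_def mu_0)
  then have out_A: "\<nu> (J 0 0) \<notin> descendants (Suc k)"
    using not_descendant_lower[of 0 "Suc k"] by (simp add: \<nu>(3))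
  obtain c where c: "c \<in> {0..1}" "dist (J ((1 - c) * T) 0) ?v \<le> \<sigma>"
    using cross[OF in_A out_A] by auto
  define t where "t = (1 - c) * T"
  have t0: "0 \<le> t" using c T by (simp add: t_def)
  have tv: "dist (J t 0) ?v \<le> \<sigma>" using c by (simp add: t_def)
  have tp: "dist (J t 0) p = t * norm u" using t0 by (simp add: J_def dist_norm)
  have "(s + 1) * norm u \<le> t * norm u"
    using v_far tv tp dist_triangle3[of ?v p "J t 0"] by (simp add: \<rho>_def)
  then have t_low: "s + 1 \<le> t" using u0 by simp
  have "t * norm u \<le> \<rho> + D + \<sigma>"
    using v_near tv tp dist_triangle[of "J t 0" p ?v] by simp
  then have "(t + s + 1) * norm u \<le> T * norm u" using Tu by (simp add: algebra_simps)
  then have t_up: "t + s + 1 \<le> T" using u0 by simp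
  have close: "\<bar>a - t\<bar> \<le> s \<and> \<bar>b\<bar> \<le> s" if "dist (J a b) ?v \<le> \<sigma>" for a b
  proof -
    have "norm ((a - t) *\<^sub>R u + b *\<^sub>R w) = dist (J a b) (J t 0)"
      by (simp add: J_def dist_norm algebra_simps)
    also have "\<dots> \<le> 2 * \<sigma>" using that tv dist_triangle2[of "J a b" "J t 0" ?v] by simp
    finally have "\<kappa> * \<bar>a - t\<bar> \<le> 2 * \<sigma>" "\<kappa> * \<bar>b\<bar> \<le> 2 * \<sigma>"
      using \<kappa>(2)[of "a - t" b] \<kappa>(3)[of b "a - t"] by linarith+
    then show ?thesis using \<kappa>(1) by (simp add: s_def field_simps)
  qed
  \<comment> \<open>The detour is crossed on its side \<open>a = T\<close>, \<open>b = ?H\<close> or \<open>a = 0\<close>.\<close>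
  let ?H = "s + 1"
  consider "\<nu> (J T ?H) \<notin> descendants (Suc k)"
    | "\<nu> (J T ?H) \<in> descendants (Suc k)" "\<nu> (J 0 ?H) \<notin> descendants (Suc k)"
    | "\<nu> (J 0 ?H) \<in> descendants (Suc k)" by blast
  then show False
  proof cases
    case 1
    then obtain c where "dist (J ((1 - c) * T + c * T) ((1 - c) * 0 + c * ?H)) ?v \<le> \<sigma>"
      using cross[OF in_A 1] by blast
    moreover have "(1 - c) * T + c * T = T" by (simp add: algebra_simps)
    ultimately show False using close t_up by fastforce
  next
    case 2
    then obtain c where "dist (J ((1 - c) * T + c * 0) ((1 - c) * ?H + c * ?H)) ?v \<le> \<sigma>"
      using cross[OF 2] by blast
    moreover have "(1 - c) * ?H + c * ?H = ?H" by (simp add: algebra_simps)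
    ultimately show False using close s by fastforce
  next
    case 3
    then obtain c where "dist (J ((1 - c) * 0 + c * 0) ((1 - c) * ?H + c * 0)) ?v \<le> \<sigma>"
      using cross[OF 3 out_A] by blast
    then show False using close t_low by fastforce
  qed
qed

lemma discrete_dense_range:
  assumes "net_in \<alpha> \<beta> UNIV N" "0 < \<alpha>" "range \<mu> \<subseteq> N" "N \<subseteq> closure (range \<mu>)"
  shows "range \<mu> = N"
proof (rule antisym[OF assms(3)], rule subsetI)
  fix x assume x: "x \<in> N"
  then obtain y where y: "y \<in> range \<mu>" "dist y x < \<alpha>"
    using assms(2,4) by (meson closure_approachable subsetD)
  then have "y = x" using assms(1,3) x unfolding net_in_def by (meson not_le subsetD)
  then show "x \<in> range \<mu>" using y by simp
qed

section \<open>Conditionality\<close>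

theorem theorem10:
  fixes N :: "'a::real_normed_vector set"
    and p :: 'a
    and \<alpha> \<beta> :: real
    and e :: "nat \<Rightarrow> ('a \<Rightarrow> real) \<Rightarrow> real"
  assumes "\<exists>B :: 'a set. finite B \<and> span B = UNIV"
    and "dim (UNIV :: 'a set) \<ge> 2"
    and "\<alpha> > 0" and "\<beta> > 0"
    and "net_in \<alpha> \<beta> UNIV N"
    and "p \<in> N"
    and "retractional_basis N p e"
  shows "conditional_basis (lip_free N p) (dual_norm N p) e"
proof -
  have basis: "schauder_basis (lip_free N p) (dual_norm N p) e"
    using assms(7) unfolding retractional_basis_def by blast
  obtain \<mu> :: "nat \<Rightarrow> 'a" and r :: "nat \<Rightarrow> 'a \<Rightarrow> 'a" and K :: real
    where mu: "inj \<mu>" "range \<mu> \<subseteq> N" "\<mu> 0 = p" "N \<subseteq> closure (range \<mu>)"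
      and r': "\<forall>n. retraction_on N (r n)" "\<forall>n. r n ` N = \<mu> ` {..n}"
        "\<forall>n. K-lipschitz_on N (r n)"
      and comm: "\<forall>m n. n \<le> m \<longrightarrow> (\<forall>x\<in>N. r m (r n x) = r n x \<and> r n (r m x) = r n x)"
      and proj: "\<forall>n\<ge>1. \<forall>f\<in>Lip0 N p. \<forall>\<phi>\<in>lip_free N p.
        basis_proj (dual_norm N p) e n \<phi> f = \<phi> (\<lambda>x. if x \<in> N then f (r n x) else 0)"
    using assms(7) unfolding retractional_basis_def
    by (elim conjE exE) (rule that, assumption+)
  note r = r'[rule_format]
  interpret retractional_free_basis N p \<mu> r \<alpha> e
  proof unfold_locales
    show "range \<mu> = N" by (rule discrete_dense_range[OF assms(5,3) mu(2,4)])
    show "\<alpha> \<le> dist x y" if "x \<in> N" "y \<in> N" "x \<noteq> y" for x y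
      using assms(5) that unfolding net_in_def by simp
    show "r n (r m x) = r n x" if "n \<le> m" "x \<in> N" for n m x
      using comm that by blast
    show "basis_proj (dual_norm N p) e n \<phi> f = \<phi> (\<lambda>x. if x \<in> N then f (r n x) else 0)"
      if "1 \<le> n" "f \<in> Lip0 N p" "\<phi> \<in> lip_free N p" for n f \<phi>
      using proj that by blast
  qed (fact mu r basis assms(3))+
  have tree: "commuting_retractions N p \<mu> r" by unfold_locales
  note step = parent_distance_bound[OF tree assms(5,4) r(3)]
  have "\<not> unconditional_basis (lip_free N p) (dual_norm N p) e"
  proof
    assume "unconditional_basis (lip_free N p) (dual_norm N p) e"
    from unconditional_imp_boundary_near_ancestor[OF this step, of "5 * \<beta>"]
    obtain C where C: "\<forall>n. \<forall>x\<in>descendants n. \<forall>y\<in>N - descendants n.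
        dist x y \<le> 5 * \<beta> \<longrightarrow> dist x (\<mu> n) \<le> C" ..
    show False
      by (rule boundaries_not_all_near_ancestors[OF tree assms(2,5,4) step, of C]) (use C in blast)
  qed
  with basis show ?thesis unfolding conditional_basis_def by blast
qed

end
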